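(* Let $\alpha\ge-1/2$ and $p_0(\alpha)<p<p_1(\alpha)$. Then for every $f\in L^p(d\mu_\alpha)$, $$\lim_{r\to1^-}P_r f=M_\alpha f\qquad\text{and}\qquad \lim_{r\to1^-}W_r f=M_\alpha f$$ almost everywhere on $(0,\infty)$.
   Context: For $\alpha\ge-1/2$, $d\mu_\alpha(x)=x^{2\alpha+1}\,dx$ on $(0,\infty)$, and $L^p(d\mu_\alpha)=L^p((0,\infty),d\mu_\alpha)$. $J_\nu$ is the Bessel function of the first kind of order $\nu$. For $n=0,1,2,\dots$, $$j_n^\alpha(x)=\sqrt{2(\alpha+2n+1)}\,J_{\alpha+2n+1}(x)\,x^{-\alpha-1},\qquad x>0,$$ which form an orthonormal system in $L^2(d\mu_\alpha)$. The exponents are $p_0(\alpha)=\frac{4(\alpha+1)}{2\alpha+3}$ and $p_1(\alpha)=\frac{4(\alpha+1)}{2\alpha+1}$ (with $p_1(-1/2)=\infty$). For $p_0(\alpha)<p<p_1(\alpha)$, each $j_n^\alpha$ lies in both $L^p(d\mu_\alpha)$ and $L^{p'}(d\mu_\alpha)$ (where $1/p+1/p'=1$), and for $f\in L^p(d\mu_\alpha)$ the Fourier coefficients are $$c_n^\alpha(f)=\int_0^\infty f(y)\,j_n^\alpha(y)\,y^{2\alpha+1}\,dy.$$ For $f\in L^p(d\mu_\alpha)$, $0<r<1$, $x>0$, $$P_r f(x)=\sum_{n=0}^\infty r^{\alpha+2n+1}c_n^\alpha(f)j_n^\alpha(x),\qquad W_r f(x)=\sum_{n=0}^\infty r^{(\alpha+2n+1)^2}c_n^\alpha(f)j_n^\alpha(x).$$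 The modified Hankel transform is $$H_\alpha f(x)=\int_0^\infty \frac{J_\alpha(xy)}{(xy)^\alpha}f(y)\,y^{2\alpha+1}\,dy,\quad x>0,$$ which extends to an isometry of $L^2(d\mu_\alpha)$. The multiplier $M_\alpha$ is defined by $H_\alpha(M_\alpha f)=\chi_{[0,1]}H_\alpha f$ for $f\in L^2(d\mu_\alpha)$; for $\alpha\ge-1/2$ and $p_0(\alpha)<p<p_1(\alpha)$ it is known to extend from $L^2(d\mu_\alpha)\cap L^p(d\mu_\alpha)$ to a bounded operator on $L^p(d\mu_\alpha)$, still denoted $M_\alpha$. *)

theory Defs
  imports "HOL-Analysis.Analysis"
begin

text \<open>Bessel function of the first kind, by its power series; used for \<open>x > 0\<close> only.
  The function \<open>rGamma\<close> is the reciprocal Gamma function.\<close>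

definition besselJ :: "real \<Rightarrow> real \<Rightarrow> real" where
  "besselJ \<nu> x =
     (\<Sum>k. (-1) ^ k * rGamma (\<nu> + real k + 1) / fact k * (x / 2) powr (\<nu> + 2 * real k))"

definition mu :: "real \<Rightarrow> real measure" where
  "mu \<alpha> = density (restrict_space lborel {0<..}) (\<lambda>x. ennreal (x powr (2 * \<alpha> + 1)))"

text \<open>Elements of \<open>Lp p M\<close> are functions, not equivalence classes, so identities between
  them are to be read almost everywhere.  \<open>Lp_norm\<close> is meaningful on \<open>Lp p M\<close> only, which is
  why \<open>Lp_converges\<close> contains the membership conditions.\<close>

definition Lp :: "real \<Rightarrow> 'a measure \<Rightarrow> ('a \<Rightarrow> complex) set" where
  "Lp p M = {f \<in> borel_measurable M. integrable M (\<lambda>x. norm (f x) powr p)}"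

definition Lp_norm :: "real \<Rightarrow> 'a measure \<Rightarrow> ('a \<Rightarrow> complex) \<Rightarrow> real" where
  "Lp_norm p M f = (\<integral>x. norm (f x) powr p \<partial>M) powr (1 / p)"

definition Lp_converges ::
  "real \<Rightarrow> 'a measure \<Rightarrow> (nat \<Rightarrow> 'a \<Rightarrow> complex) \<Rightarrow> ('a \<Rightarrow> complex) \<Rightarrow> bool" where
  "Lp_converges p M u f \<longleftrightarrow>
     (\<forall>k. u k \<in> Lp p M) \<and> f \<in> Lp p M \<and>
     (\<lambda>k. Lp_norm p M (\<lambda>x. u k x - f x)) \<longlonglongrightarrow> 0"

definition bounded_Lp_operator ::
  "real \<Rightarrow> 'a measure \<Rightarrow> (('a \<Rightarrow> complex) \<Rightarrow> 'a \<Rightarrow> complex) \<Rightarrow> bool" where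
  "bounded_Lp_operator p M T \<longleftrightarrow>
     (\<forall>f\<in>Lp p M. T f \<in> Lp p M) \<and>
     (\<forall>f\<in>Lp p M. \<forall>g\<in>Lp p M. AE x in M. T (\<lambda>y. f y + g y) x = T f x + T g x) \<and>
     (\<forall>c. \<forall>f\<in>Lp p M. AE x in M. T (\<lambda>y. c * f y) x = c * T f x) \<and>
     (\<exists>C. \<forall>f\<in>Lp p M. Lp_norm p M (T f) \<le> C * Lp_norm p M f)"

definition p0 :: "real \<Rightarrow> real" where
  "p0 \<alpha> = 4 * (\<alpha> + 1) / (2 * \<alpha> + 3)"

definition p1 :: "real \<Rightarrow> ereal" where
  "p1 \<alpha> = (if \<alpha> = -1/2 then \<infinity> else ereal (4 * (\<alpha> + 1) / (2 * \<alpha> + 1)))"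

definition j :: "real \<Rightarrow> nat \<Rightarrow> real \<Rightarrow> real" where
  "j \<alpha> n x =
     sqrt (2 * (\<alpha> + 2 * real n + 1)) * besselJ (\<alpha> + 2 * real n + 1) x * x powr (- \<alpha> - 1)"

definition coef :: "real \<Rightarrow> (real \<Rightarrow> complex) \<Rightarrow> nat \<Rightarrow> complex" where
  "coef \<alpha> f n = (\<integral>y. f y * complex_of_real (j \<alpha> n y) \<partial>mu \<alpha>)"

definition P :: "real \<Rightarrow> real \<Rightarrow> (real \<Rightarrow> complex) \<Rightarrow> real \<Rightarrow> complex" where
  "P \<alpha> r f x =
     (\<Sum>n. complex_of_real (r powr (\<alpha> + 2 * real n + 1)) * coef \<alpha> f n
            * complex_of_real (j \<alpha> n x))"

definition W :: "real \<Rightarrow> real \<Rightarrow> (real \<Rightarrow> complex) \<Rightarrow> real \<Rightarrow> complex" where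
  "W \<alpha> r f x =
     (\<Sum>n. complex_of_real (r powr ((\<alpha> + 2 * real n + 1)\<^sup>2)) * coef \<alpha> f n
            * complex_of_real (j \<alpha> n x))"

definition hankel :: "real \<Rightarrow> (real \<Rightarrow> complex) \<Rightarrow> real \<Rightarrow> complex" where
  "hankel \<alpha> f x =
     (\<integral>y. complex_of_real (besselJ \<alpha> (x * y) / (x * y) powr \<alpha>) * f y \<partial>mu \<alpha>)"

text \<open>\<open>hankel_L2 \<alpha> f g\<close>: the function \<open>g\<close> is a representative of the image of \<open>f\<close> under the
  continuous extension to \<open>L\<^sup>2\<close> of the integral transform, which converges absolutely on
  \<open>L\<^sup>1 \<inter> L\<^sup>2\<close>.\<close>

definition hankel_L2 :: "real \<Rightarrow> (real \<Rightarrow> complex) \<Rightarrow> (real \<Rightarrow> complex) \<Rightarrow> bool" where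
  "hankel_L2 \<alpha> f g \<longleftrightarrow>
     (\<exists>u. (\<forall>k. u k \<in> Lp 1 (mu \<alpha>)) \<and> Lp_converges 2 (mu \<alpha>) u f \<and>
          Lp_converges 2 (mu \<alpha>) (\<lambda>k. hankel \<alpha> (u k)) g)"

text \<open>\<open>multiplier_L2 \<alpha> f g\<close>: the function \<open>g\<close> is a representative of \<open>M\<^sub>\<alpha> f\<close>, for \<open>f\<close> in \<open>L\<^sup>2\<close>.\<close>

definition multiplier_L2 :: "real \<Rightarrow> (real \<Rightarrow> complex) \<Rightarrow> (real \<Rightarrow> complex) \<Rightarrow> bool" where
  "multiplier_L2 \<alpha> f g \<longleftrightarrow>
     (\<exists>F G. hankel_L2 \<alpha> f F \<and> hankel_L2 \<alpha> g G \<and>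
            (AE x in mu \<alpha>. G x = indicator {0..1} x * F x))"

text \<open>\<open>T\<close> is the operator \<open>M\<^sub>\<alpha>\<close> on \<open>L\<^sup>p\<close>.  As \<open>L\<^sup>2 \<inter> L\<^sup>p\<close> is dense in \<open>L\<^sup>p\<close>, this determines
  each \<open>T f\<close> up to a null set.\<close>

definition is_multiplier ::
  "real \<Rightarrow> real \<Rightarrow> ((real \<Rightarrow> complex) \<Rightarrow> real \<Rightarrow> complex) \<Rightarrow> bool" where
  "is_multiplier \<alpha> p T \<longleftrightarrow>
     bounded_Lp_operator p (mu \<alpha>) T \<and>
     (\<forall>f \<in> Lp 2 (mu \<alpha>) \<inter> Lp p (mu \<alpha>). multiplier_L2 \<alpha> f (T f))"

end

theory Submission
  imports Defs
begin

text \<open>For fixed \<open>x\<close> the value \<open>j \<alpha> n x\<close> decays superexponentially in \<open>n\<close>, while the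
  coefficients grow at most exponentially, so the series \<open>S f\<close> with \<open>r = 1\<close> converges absolutely
  at every point and is the limit of both means; what has to be shown is \<open>S f = M f\<close> almost
  everywhere.  The expansion of the kernel \<open>K(x,y) = \<Sum> j\<^sub>n(x) j\<^sub>n(y)\<close> telescopes to the integral of
  the product of two Hankel kernels over \<open>[0,1]\<close>, so \<open>S f\<close> is the Hankel transform of the
  restriction of the Hankel transform of \<open>f\<close> to \<open>[0,1]\<close> when \<open>f\<close> is integrable.  Gaussians are
  mapped to Gaussians and separate functions, which identifies this with \<open>M f\<close> for
  integrable \<open>f\<close> in \<open>L\<^sup>2\<close> without Plancherel.  Truncation and the boundedness of \<open>M\<close> do the rest.\<close>

section \<open>Bessel functions without their power factor\<close>

text \<open>The quantitative obstacle is the growth of the coefficients: their bound has to be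
  explicit in \<open>n\<close>, so the decay J_\<nu>(x) = O(x^(-1/2)) is needed together with its
  dependence on \<nu>. It is extracted from the Bessel equation by monotone functionals. The upper
  bound on \<open>p\<close> says that the resulting profile, of size x^(-\<alpha> - 3/2) at
  infinity, lies in the dual space of L^p. The function \<open>phi \<nu>\<close> is the
  Bessel-Clifford function at \<open>- z\<close>, that is J_\<nu>(x) (x/2)^(-\<nu>) with z = x^2/4.
  It is entire, and differentiation merely raises the order, so nothing singular happens at 0. The
  assumption on \<open>M\<close> supplies L^2 Hankel images of a function and of its image under
  \<open>M\<close> as witnesses. Only their identification has to be proved, never their existence,
  and pairings with Gaussians are enough for that.\<close>

definition phi :: "real \<Rightarrow> real \<Rightarrow> real" where
  "phi \<nu> z = (\<Sum>k. (-1) ^ k * rGamma (\<nu> + real k + 1) / fact k * z ^ k)"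

lemma rGamma_pos: "0 < x \<Longrightarrow> 0 < rGamma (x::real)"
  by (simp add: rGamma_inverse_Gamma Gamma_real_pos)

lemma rGamma_rec: "rGamma x = x * rGamma (x + 1)" for x :: real
  by (simp add: rGamma_plus1)

text \<open>Each step of the recurrence divides by \<open>\<nu> + k + 1\<close>, which is at least
  \<open>(k + 1) / 2\<close> because \<open>\<nu> \<ge> -1/2\<close>. The factorial gained here
  makes the series converge everywhere and later kills the remainder of the kernel
  expansion.\<close>

lemma rGamma_growth:
  assumes "\<nu> \<ge> -1/2"
  shows "rGamma (\<nu> + real k + 1) \<le> 2 ^ k / fact k * rGamma (\<nu> + 1)"
proof (induction k)
  case (Suc k)
  have "rGamma (\<nu> + real k + 1) = (\<nu> + real k + 1) * rGamma (\<nu> + real (Suc k) + 1)"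
    using rGamma_rec[of "\<nu> + real k + 1"] by (simp add: algebra_simps)
  moreover have "real (Suc k) / 2 * rGamma (\<nu> + real (Suc k) + 1) \<le> (\<nu> + real k + 1) * rGamma (\<nu> + real (Suc k) + 1)"
    using assms by (intro mult_right_mono less_imp_le[OF rGamma_pos]) auto
  ultimately have "real (Suc k) / 2 * rGamma (\<nu> + real (Suc k) + 1) \<le> 2 ^ k / fact k * rGamma (\<nu> + 1)"
    using Suc by linarith
  then show ?case by (simp add: field_simps del: of_nat_Suc)
qed simp

lemma summable_phi:
  assumes "\<nu> \<ge> -1/2"
  shows "summable (\<lambda>k. (-1) ^ k * rGamma (\<nu> + real k + 1) / fact k * z ^ k)"
proof (rule summable_comparison_test'[where N = 0])
  have "summable (\<lambda>k. rGamma (\<nu> + 1) * (inverse (fact k) * (2 * \<bar>z\<bar>) ^ k))"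
    by (intro summable_mult summable_exp)
  then show "summable (\<lambda>k. rGamma (\<nu> + 1) * (2 * \<bar>z\<bar>) ^ k / fact k)"
    by (simp add: field_simps)
  fix k :: nat
  have r: "rGamma (\<nu> + 1) > 0" "rGamma (\<nu> + real k + 1) > 0"
    using assms by (auto intro: rGamma_pos)
  have "2 ^ k / fact k * rGamma (\<nu> + 1) \<le> 2 ^ k / 1 * rGamma (\<nu> + 1)"
    using r by (intro mult_right_mono divide_left_mono) auto
  then have "rGamma (\<nu> + real k + 1) \<le> 2 ^ k * rGamma (\<nu> + 1)"
    using rGamma_growth[OF assms, of k] by simp
  then have "rGamma (\<nu> + real k + 1) * \<bar>z\<bar> ^ k / fact k \<le> (2 ^ k * rGamma (\<nu> + 1)) * \<bar>z\<bar> ^ k / fact k"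
    by (intro divide_right_mono mult_right_mono) auto
  then show "norm ((-1) ^ k * rGamma (\<nu> + real k + 1) / fact k * z ^ k) \<le> rGamma (\<nu> + 1) * (2 * \<bar>z\<bar>) ^ k / fact k"
    using r by (simp add: abs_mult power_abs power_mult_distrib mult_ac)
qed

lemma phi_deriv:
  assumes "\<nu> \<ge> -1/2"
  shows "(phi \<nu> has_real_derivative - phi (\<nu> + 1) z) (at z)"
proof -
  let ?c = "\<lambda>\<nu> k. (-1) ^ k * rGamma (\<nu> + real k + 1) / fact k :: real"
  have 1: "((\<lambda>z. \<Sum>k. ?c \<nu> k * z ^ k) has_field_derivative (\<Sum>k. diffs (?c \<nu>) k * z ^ k)) (at z)"
    by (rule termdiffs_strong_converges_everywhere) (rule summable_phi[OF assms])
  have 2: "diffs (?c \<nu>) k = - ?c (\<nu> + 1) k" for k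
    by (simp add: diffs_def field_simps del: of_nat_Suc) (simp add: algebra_simps)
  have 3: "(\<Sum>k. diffs (?c \<nu>) k * z ^ k) = - phi (\<nu> + 1) z"
    unfolding 2 phi_def
    using suminf_minus[OF summable_phi[of "\<nu> + 1" z]] assms by simp
  show ?thesis using 1 unfolding 3 phi_def[symmetric] .
qed

text \<open>Together with \<open>phi_deriv\<close> this is the Bessel equation z u'' + (\<nu> + 1)
  u' + u = 0 for u = \<open>phi \<nu>\<close>. The proof compares coefficients.\<close>

lemma phi_rec:
  assumes "\<nu> \<ge> -1/2"
  shows "z * phi (\<nu> + 2) z = (\<nu> + 1) * phi (\<nu> + 1) z - phi \<nu> z"
proof -
  let ?c = "\<lambda>\<nu> k. (-1) ^ k * rGamma (\<nu> + real k + 1) / fact k :: real"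
  have S: "(\<lambda>k. ?c \<nu> k * z ^ k) sums phi \<nu> z" if "\<nu> \<ge> -1/2" for \<nu>
    unfolding phi_def using summable_phi[OF that] by (rule summable_sums)
  have "(\<lambda>k. (\<nu> + 1) * (?c (\<nu> + 1) k * z ^ k) - ?c \<nu> k * z ^ k) sums ((\<nu> + 1) * phi (\<nu> + 1) z - phi \<nu> z)"
    using assms by (intro sums_diff sums_mult S) auto
  moreover have "(\<nu> + 1) * (?c (\<nu> + 1) k * z ^ k) - ?c \<nu> k * z ^ k = - real k * (?c (\<nu> + 1) k * z ^ k)" for k
    using rGamma_rec[of "\<nu> + real k + 1"] by (simp add: field_simps)
  ultimately have "(\<lambda>k. - real k * (?c (\<nu> + 1) k * z ^ k)) sums ((\<nu> + 1) * phi (\<nu> + 1) z - phi \<nu> z)"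
    by simp
  \<comment> \<open>The factor \<open>real k\<close> annihilates the term \<open>k = 0\<close>, so
    the index can be shifted.\<close>
  then have "(\<lambda>k. - real (Suc k) * (?c (\<nu> + 1) (Suc k) * z ^ Suc k)) sums ((\<nu> + 1) * phi (\<nu> + 1) z - phi \<nu> z)"
    by (subst sums_Suc_iff) simp
  moreover have "- real (Suc k) * (?c (\<nu> + 1) (Suc k) * z ^ Suc k) = z * (?c (\<nu> + 2) k * z ^ k)" for k
    by (simp add: field_simps del: of_nat_Suc) (simp add: algebra_simps)
  ultimately have "(\<lambda>k. z * (?c (\<nu> + 2) k * z ^ k)) sums ((\<nu> + 1) * phi (\<nu> + 1) z - phi \<nu> z)"
    by simp
  moreover have "(\<lambda>k. z * (?c (\<nu> + 2) k * z ^ k)) sums (z * phi (\<nu> + 2) z)"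
    using assms by (intro sums_mult S) auto
  ultimately show ?thesis by (simp add: sums_unique2)
qed

lemma besselJ_phi:
  assumes "\<nu> \<ge> -1/2" "x > 0"
  shows "besselJ \<nu> x = (x / 2) powr \<nu> * phi \<nu> (x\<^sup>2 / 4)"
proof -
  have "(x / 2) powr (\<nu> + 2 * real k) = (x / 2) powr \<nu> * (x\<^sup>2 / 4) ^ k" for k
  proof -
    have "(x / 2) powr (2 * real k) = (x / 2) ^ (2 * k)"
      using assms powr_realpow[of "x / 2" "2 * k"] by simp
    then show ?thesis by (simp add: powr_add power_mult power_divide)
  qed
  then have "besselJ \<nu> x = (\<Sum>k. (x / 2) powr \<nu> * ((-1) ^ k * rGamma (\<nu> + real k + 1) / fact k * (x\<^sup>2 / 4) ^ k))"
    unfolding besselJ_def by (simp add: mult_ac)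
  also have "\<dots> = (x / 2) powr \<nu> * phi \<nu> (x\<^sup>2 / 4)"
    unfolding phi_def by (rule suminf_mult[OF summable_phi[OF assms(1)]])
  finally show ?thesis .
qed

lemma phi_0: "phi \<nu> 0 = rGamma (\<nu> + 1)"
  unfolding phi_def using powser_zero[of "\<lambda>k. (-1) ^ k * rGamma (\<nu> + real k + 1) / fact k"] by simp

lemma continuous_on_phi [continuous_intros]:
  assumes "\<nu> \<ge> -1/2" "continuous_on A g"
  shows "continuous_on A (\<lambda>x. phi \<nu> (g x))"
proof -
  have "continuous_on UNIV (phi \<nu>)"
    using phi_deriv[OF assms(1)] by (meson DERIV_continuous_on UNIV_I has_field_derivative_at_within)
  then show ?thesis using assms(2) by (rule continuous_on_compose2) auto
qed

section \<open>Energy estimates and decay of Bessel functions\<close>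

lemma phi_energy:
  assumes "\<nu> \<ge> -1/2" "z \<ge> 0"
  shows "(phi \<nu> z)\<^sup>2 + z * (phi (\<nu> + 1) z)\<^sup>2 \<le> (rGamma (\<nu> + 1))\<^sup>2"
proof -
  \<comment> \<open>With u = \<open>phi \<nu>\<close> this is the energy u^2 + z u'^2 of the Bessel
    equation. Its derivative -(2 \<nu> + 1) u'^2 is a damping term for
    \<open>\<nu> \<ge> -1/2\<close>, so the value at 0 bounds it.\<close>
  let ?e = "\<lambda>z. (phi \<nu> z)\<^sup>2 + z * (phi (\<nu> + 1) z)\<^sup>2"
  have D: "(?e has_real_derivative - (2 * \<nu> + 1) * (phi (\<nu> + 1) z)\<^sup>2) (at z)" for z
  proof -
    have 1: "(phi (\<nu> + 1) has_real_derivative - phi (\<nu> + 2) z) (at z)"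
      using phi_deriv[of "\<nu> + 1" z] assms by (simp add: add.assoc)
    have 2: "(?e has_real_derivative 2 * phi \<nu> z * (- phi (\<nu> + 1) z) + ((phi (\<nu> + 1) z)\<^sup>2
        + z * (2 * phi (\<nu> + 1) z * (- phi (\<nu> + 2) z)))) (at z)"
      by (rule derivative_eq_intros 1 phi_deriv[OF assms(1)] refl | simp)+
    have 3: "2 * phi \<nu> z * (- phi (\<nu> + 1) z) + ((phi (\<nu> + 1) z)\<^sup>2
        + z * (2 * phi (\<nu> + 1) z * (- phi (\<nu> + 2) z))) = - (2 * \<nu> + 1) * (phi (\<nu> + 1) z)\<^sup>2"
      using phi_rec[OF assms(1), of z] by algebra
    show ?thesis using 2 unfolding 3 .
  qed
  have "?e z \<le> ?e 0"
    using assms by (intro DERIV_nonpos_imp_nonincreasing[of 0 z ?e]) (auto intro!: exI D mult_nonpos_nonneg)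
  then show ?thesis by (simp add: phi_0)
qed

lemma phi_bound:
  assumes "\<nu> \<ge> -1/2" "z \<ge> 0"
  shows "\<bar>phi \<nu> z\<bar> \<le> rGamma (\<nu> + 1)"
proof -
  have "(phi \<nu> z)\<^sup>2 \<le> (rGamma (\<nu> + 1))\<^sup>2"
    using phi_energy[OF assms] assms by (smt (verit) mult_nonneg_nonneg zero_le_power2)
  then show ?thesis using rGamma_pos[of "\<nu> + 1"] assms by (simp add: abs_le_square_iff[symmetric])
qed

text \<open>For J_\<nu> this is the order x^(-1/2), with a constant explicit in \<nu>. The constant:
  at \<open>a\<^sup>2\<close> the exponential contributes at most 3 and \<open>Q\<close> at most 3/2
  of the energy, hence 9/2; the remaining factor 2 is the loss in passing from \<open>Q\<close> to
  the square of \<open>phi\<close>.\<close>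

lemma phi_decay_aux:
  assumes "\<nu> \<ge> 1/2" and z: "z \<ge> (\<nu> + 1/2)\<^sup>2"
  defines "a \<equiv> \<nu> + 1/2"
  shows "z powr a * (phi \<nu> z)\<^sup>2 \<le> 9 * (a powr a)\<^sup>2 * (rGamma (\<nu> + 1))\<^sup>2"
proof -
  \<comment> \<open>The leading part of \<open>z powr a * Q z\<close> has a derivative of indefinite sign and order
    \<open>z powr (a - 1)\<close>; the cross term cancels it up to a factor \<open>1 / sqrt z\<close>, which the exponential
    in \<open>G\<close> absorbs.\<close>
  define Q where "Q = (\<lambda>z. (phi \<nu> z)\<^sup>2 + z * (phi (\<nu> + 1) z)\<^sup>2 - a * phi \<nu> z * phi (\<nu> + 1) z)"
  define G where "G = (\<lambda>z. z powr a * Q z * exp (a / sqrt z))"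
  have a: "a \<ge> 1" using assms by simp
  have cross: "s * \<bar>u * v\<bar> \<le> (u\<^sup>2 + s\<^sup>2 * v\<^sup>2) / 2" if "s > 0" for s u v :: real
    using that zero_le_power2[of "\<bar>u\<bar> - s * \<bar>v\<bar>"] by (simp add: power2_diff abs_mult power_mult_distrib mult_ac)
  have D: "\<exists>y. (G has_real_derivative y) (at z) \<and> y \<le> 0" if "a\<^sup>2 \<le> z" for z
  proof -
    define s where "s = sqrt z"
    have "0 < a\<^sup>2" using a by simp
    then have z: "z > 0" using that by linarith
    have s: "s > 0" "z = s\<^sup>2" using z by (auto simp: s_def)
    have as: "a \<le> s" using that s a unfolding s(2) by (simp add: power2_le_iff_abs_le)
    let ?u = "phi \<nu> z" and ?v = "phi (\<nu> + 1) z" and ?w = "phi (\<nu> + 2) z"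
    have rec: "z * ?w = (\<nu> + 1) * ?v - ?u" using phi_rec[of \<nu> z] assms by simp
    have d1: "(phi (\<nu> + 1) has_real_derivative - ?w) (at z)"
      using phi_deriv[of "\<nu> + 1" z] assms by (simp add: add.assoc)
    have d0: "(phi \<nu> has_real_derivative - ?v) (at z)"
      using phi_deriv[of "\<nu>" z] assms by simp
    have q: "(Q has_real_derivative 2 * ?u * (- ?v) + (?v\<^sup>2 + z * (2 * ?v * (- ?w)))
         - (a * (- ?v) * ?v + a * ?u * (- ?w))) (at z)"
      unfolding Q_def
      by (rule derivative_eq_intros d0 d1 refl | simp)+
    have e: "((\<lambda>z. exp (a / sqrt z)) has_real_derivative exp (a / s) * (- a / (2 * s ^ 3))) (at z)"
      using z unfolding s_def
      by (auto intro!: derivative_eq_intros simp: field_simps power3_eq_cube)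
    have p: "((\<lambda>z. z powr a) has_real_derivative a * z powr (a - 1)) (at z)"
      using z by (rule has_real_derivative_powr)
    have "(G has_real_derivative 
        (a * z powr (a - 1) * Q z + z powr a * (2 * ?u * (- ?v) + (?v\<^sup>2 + z * (2 * ?v * (- ?w)))
         - (a * (- ?v) * ?v + a * ?u * (- ?w)))) * exp (a / s) + z powr a * Q z * (exp (a / s) * (- a / (2 * s ^ 3)))) (at z)"
      unfolding G_def using DERIV_mult[OF DERIV_mult[OF p q] e] unfolding s_def by (rule DERIV_cong) (simp add: mult_ac add_ac)
    also have "z powr a = z * z powr (a - 1)" using z by (simp add: powr_diff)
    also have "(a * z powr (a - 1) * Q z + z * z powr (a - 1) * (2 * ?u * (- ?v) + (?v\<^sup>2 + z * (2 * ?v * (- ?w)))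
         - (a * (- ?v) * ?v + a * ?u * (- ?w))))
        = z powr (a - 1) * (a / 2 * (?u * ?v))"
    proof -
      have "a * Q z + z * (2 * ?u * (- ?v) + (?v\<^sup>2 + z * (2 * ?v * (- ?w)))
         - (a * (- ?v) * ?v + a * ?u * (- ?w))) = a * Q z + (z * (?v\<^sup>2 - 2 * ?u * ?v + a * ?v\<^sup>2)
          - 2 * z * ?v * (z * ?w) + a * ?u * (z * ?w))"
        by (simp add: algebra_simps power2_eq_square)
      also have "\<dots> = a / 2 * (?u * ?v)"
        unfolding rec Q_def a_def by (simp add: algebra_simps power2_eq_square add_divide_distrib)
      finally show ?thesis by algebra
    qed
    also have "z powr (a - 1) * (a / 2 * (?u * ?v)) * exp (a / s) + z * z powr (a - 1) * Q z * (exp (a / s) * (- a / (2 * s ^ 3)))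
       = z powr (a - 1) * exp (a / s) * (a / (2 * s)) * (s * (?u * ?v) - Q z)"
      using s(1) unfolding s(2) by (simp add: field_simps power2_eq_square power3_eq_cube)
    finally have 1: "(G has_real_derivative \<dots>) (at z)" .
    \<comment> \<open>The threshold for \<open>z\<close> enters here: s u v - Q equals (s + a) u v -
      (u^2 + s^2 v^2), and \<open>a \<le> s\<close> lets \<open>cross\<close> absorb the
      product.\<close>
    have "(s + a) * (?u * ?v) \<le> (s + s) * \<bar>?u * ?v\<bar>"
      using s(1) as a by (intro order_trans[OF mult_left_mono[OF abs_ge_self] mult_right_mono]) auto
    then have "(s + a) * (?u * ?v) \<le> ?u\<^sup>2 + s\<^sup>2 * ?v\<^sup>2"
      using cross[OF s(1), of ?u ?v] by simp
    then have "s * (?u * ?v) - Q z \<le> 0"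
      unfolding Q_def s(2)[symmetric] by (simp add: algebra_simps)
    then have "z powr (a - 1) * exp (a / s) * (a / (2 * s)) * (s * (?u * ?v) - Q z) \<le> 0"
      using s a by (intro mult_nonneg_nonpos) auto
    with 1 show ?thesis by blast
  qed
  have "G z \<le> G (a\<^sup>2)"
  proof (rule DERIV_nonpos_imp_nonincreasing[of "a\<^sup>2" z G])
    show "a\<^sup>2 \<le> z" using z by (simp add: a_def)
  qed (rule D)
  also have "G (a\<^sup>2) = (a powr a)\<^sup>2 * Q (a\<^sup>2) * exp 1"
    using a by (simp add: G_def power2_eq_square powr_mult)
  also have "\<dots> \<le> (a powr a)\<^sup>2 * (3 / 2 * (rGamma (\<nu> + 1))\<^sup>2) * 3"
  proof -
    let ?u = "phi \<nu> (a\<^sup>2)" and ?v = "phi (\<nu> + 1) (a\<^sup>2)"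
    have "Q (a\<^sup>2) \<le> 3 / 2 * (?u\<^sup>2 + a\<^sup>2 * ?v\<^sup>2)"
      using cross[of a ?u ?v] a mult_left_mono[OF abs_ge_minus_self[of "?u * ?v"], of a]
      by (simp add: Q_def mult.assoc)
    also have "\<dots> \<le> 3 / 2 * (rGamma (\<nu> + 1))\<^sup>2"
      using phi_energy[of \<nu> "a\<^sup>2"] assms by simp
    finally have "Q (a\<^sup>2) \<le> 3 / 2 * (rGamma (\<nu> + 1))\<^sup>2" .
    then show ?thesis
      using exp_le by (intro mult_mono[OF mult_left_mono]) auto
  qed
  finally have G: "G z \<le> 9 / 2 * (a powr a)\<^sup>2 * (rGamma (\<nu> + 1))\<^sup>2" by simp
  \<comment> \<open>The way back from \<open>G\<close> to \<open>phi\<close>: beyond the threshold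
    the cross term costs at most half of the energy, so \<open>Q\<close> still dominates half of the
    square of \<open>phi\<close>.\<close>
  define s where "s = sqrt z"
  have z': "a\<^sup>2 \<le> z" using z by (simp add: a_def)
  have "0 < a\<^sup>2" using a by simp
  then have zp: "z > 0" using z' by linarith
  have s: "s > 0" "z = s\<^sup>2" using zp by (auto simp: s_def)
  have as: "a \<le> s" using z' s a unfolding s(2) by (simp add: power2_le_iff_abs_le)
  let ?u = "phi \<nu> z" and ?v = "phi (\<nu> + 1) z"
  have "a * (?u * ?v) \<le> s * \<bar>?u * ?v\<bar>"
    using as a by (intro order_trans[OF mult_left_mono[OF abs_ge_self] mult_right_mono]) auto
  then have "a * (?u * ?v) \<le> (?u\<^sup>2 + z * ?v\<^sup>2) / 2"
    using cross[OF s(1), of ?u ?v, folded s(2)] by (rule order_trans)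
  moreover have "0 \<le> z * ?v\<^sup>2" using zp by simp
  ultimately have Q: "?u\<^sup>2 \<le> 2 * Q z" by (simp add: Q_def mult.assoc)
  then have "Q z \<ge> 0" using zero_le_power2[of ?u] by linarith
  have "1 \<le> exp (a / sqrt z)" using a zp by simp
  then have "z powr a * Q z * 1 \<le> z powr a * Q z * exp (a / sqrt z)"
    using \<open>Q z \<ge> 0\<close> by (intro mult_left_mono) auto
  then have "z powr a * Q z \<le> G z" by (simp add: G_def)
  moreover have "z powr a * ?u\<^sup>2 \<le> z powr a * (2 * Q z)" using Q by (intro mult_left_mono) auto
  ultimately show ?thesis using G by simp
qed

text \<open>Beyond \<open>a\<^sup>2\<close> this is the square root of \<open>phi_decay_aux\<close>.
  Below it, \<open>z powr (a / 2)\<close> is at most \<open>a powr a\<close> and the uniform bound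
  suffices.\<close>

lemma phi_decay:
  assumes "\<nu> \<ge> 1/2" "z \<ge> 0"
  defines "a \<equiv> \<nu> + 1/2"
  shows "z powr (a / 2) * \<bar>phi \<nu> z\<bar> \<le> 3 * a powr a * rGamma (\<nu> + 1)"
proof (cases "z \<ge> a\<^sup>2")
  case True
  have "(z powr (a / 2) * \<bar>phi \<nu> z\<bar>)\<^sup>2 = z powr a * (phi \<nu> z)\<^sup>2"
    by (simp add: power_mult_distrib) (simp add: power2_eq_square flip: powr_add)
  also have "\<dots> \<le> (3 * a powr a * rGamma (\<nu> + 1))\<^sup>2"
    using phi_decay_aux[OF assms(1), of z] True by (simp add: a_def power_mult_distrib)
  finally show ?thesis
    by (rule power2_le_imp_le) (use assms less_imp_le[OF rGamma_pos] in simp)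
next
  case False
  have a: "a \<ge> 1" using assms by simp
  have "z powr (a / 2) \<le> (a\<^sup>2) powr (a / 2)" using False assms by (intro powr_mono2) auto
  also have "\<dots> = a powr a" using a by (simp add: powr_powr flip: powr_numeral)
  finally have "z powr (a / 2) * \<bar>phi \<nu> z\<bar> \<le> a powr a * rGamma (\<nu> + 1)"
    using phi_bound[of \<nu> z] assms by (intro mult_mono) auto
  also have "\<dots> \<le> 3 * a powr a * rGamma (\<nu> + 1)"
    using rGamma_pos[of "\<nu> + 1"] assms by simp
  finally show ?thesis .
qed

section \<open>The measure and bounds for the functions j\<close>

lemma space_mu [simp]: "space (mu \<alpha>) = {0<..}"
  by (simp add: mu_def space_restrict_space)

lemma measurable_powr_restrict [measurable]:
  "(\<lambda>x::real. x powr a) \<in> borel_measurable (restrict_space lborel {0<..})"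
  by (rule measurable_restrict_space1) simp

lemma sets_mu [measurable_cong, simp]: "sets (mu \<alpha>) = sets (restrict_space borel {0<..})"
  by (simp add: mu_def sets_restrict_space)

lemma measurable_muI: "f \<in> measurable borel N \<Longrightarrow> f \<in> measurable (mu \<alpha>) N"
  by (subst measurable_cong_sets[OF sets_mu refl]) (rule measurable_restrict_space1)

lemma continuous_mu_measurable:
  "continuous_on {0<..} f \<Longrightarrow> f \<in> borel_measurable (mu \<alpha>)"
  by (subst measurable_cong_sets[OF sets_mu refl]) (rule borel_measurable_continuous_on_restrict)

lemma integrable_mu:
  fixes g :: "real \<Rightarrow> 'b::{banach, second_countable_topology}"
  assumes "g \<in> borel_measurable (mu \<alpha>)"
  shows "integrable (mu \<alpha>) g \<longleftrightarrow> set_integrable lborel {0<..} (\<lambda>x. x powr (2 * \<alpha> + 1) *\<^sub>R g x)"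
proof -
  have g: "g \<in> borel_measurable (restrict_space lborel {0<..})"
    using assms by (simp add: mu_def)
  show ?thesis
    unfolding mu_def set_integrable_def
    by (subst integrable_density[OF g]) (auto simp: integrable_restrict_space)
qed

lemma integral_mu:
  fixes g :: "real \<Rightarrow> 'b::{banach, second_countable_topology}"
  assumes "g \<in> borel_measurable (mu \<alpha>)"
  shows "(\<integral>x. g x \<partial>mu \<alpha>) = (LINT x:{0<..}|lborel. x powr (2 * \<alpha> + 1) *\<^sub>R g x)"
proof -
  have g: "g \<in> borel_measurable (restrict_space lborel {0<..})"
    using assms by (simp add: mu_def)
  show ?thesis
    unfolding mu_def set_lebesgue_integral_def
    by (subst integral_density[OF g]) (auto simp: integral_restrict_space)
qed

lemma AE_mu: "(AE x in mu \<alpha>. Q x) \<longleftrightarrow> (AE x in lborel. 0 < x \<longrightarrow> Q x)"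
proof -
  have "(AE x in mu \<alpha>. Q x) \<longleftrightarrow> (AE x in restrict_space lborel {0<..}. 0 < ennreal (x powr (2 * \<alpha> + 1)) \<longrightarrow> Q x)"
    unfolding mu_def by (subst AE_density) auto
  also have "\<dots> \<longleftrightarrow> (AE x in lborel. x \<in> {0<..} \<longrightarrow> 0 < ennreal (x powr (2 * \<alpha> + 1)) \<longrightarrow> Q x)"
    by (subst AE_restrict_space_iff) auto
  also have "\<dots> \<longleftrightarrow> (AE x in lborel. 0 < x \<longrightarrow> Q x)"
    by (rule AE_cong) auto
  finally show ?thesis .
qed

interpretation mu: sigma_finite_measure "mu \<alpha>"
proof -
  have "sigma_finite_measure (restrict_space lborel {0::real<..})"
    by (rule sigma_finite_measure_restrict_space) (auto simp: sigma_finite_lborel)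
  then show "sigma_finite_measure (mu \<alpha>)"
    unfolding mu_def by (subst sigma_finite_measure.sigma_finite_iff_density_finite) auto
qed

lemma set_integrable_powr_at_top:
  assumes "e < (-1::real)"
  shows "set_integrable lborel {1..} (\<lambda>x. x powr e)"
proof -
  have "(\<lambda>x::real. x powr e) integrable_on {1..}"
    using has_integral_powr_to_inf[of e 1] assms by (auto simp: integrable_on_def)
  then have "(\<lambda>x::real. x powr e) absolutely_integrable_on {1..}"
    by (rule nonnegative_absolutely_integrable_1) auto
  then have "integrable lebesgue (\<lambda>x. indicator {1..} x *\<^sub>R x powr e)"
    by (simp add: set_integrable_def)
  then show ?thesis
    unfolding set_integrable_def by (subst (asm) integrable_completion) auto
qed

lemma integrable_mu_Icc:
  assumes "\<alpha> \<ge> -1/2"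
  shows "integrable (mu \<alpha>) (indicator {0..b} :: real \<Rightarrow> real)"
proof -
  have "set_integrable lborel {0<..} (\<lambda>x::real. x powr (2 * \<alpha> + 1) *\<^sub>R (indicator {0..b} x :: real))"
    unfolding set_integrable_def
  proof (rule Bochner_Integration.integrable_bound)
    have "integrable lborel (indicator {0..b} :: real \<Rightarrow> real)"
      by (rule integrable_real_indicator) (auto simp: emeasure_lborel_Icc_eq)
    then show "integrable lborel (\<lambda>x. b powr (2 * \<alpha> + 1) * indicator {0..b} x :: real)" by simp
    show "AE x in lborel. norm (indicator {0<..} x *\<^sub>R x powr (2 * \<alpha> + 1) *\<^sub>R (indicator {0..b} x :: real))
        \<le> norm (b powr (2 * \<alpha> + 1) * indicator {0..b} x :: real)"
      using assms by (auto simp: indicator_def intro!: powr_mono2)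
  qed auto
  then show ?thesis
    by (subst integrable_mu) (auto intro: measurable_muI)
qed

text \<open>The common decay profile of all \<open>j \<alpha> n\<close>; its conjugate integrability is what the range
  of \<open>p\<close> encodes.\<close>

definition profile :: "real \<Rightarrow> real \<Rightarrow> real" where
  "profile \<alpha> x = (if x \<le> 1 then 1 else x powr (- \<alpha> - 3/2))"

lemma profile_nonneg [simp]: "0 \<le> profile \<alpha> x"
  by (simp add: profile_def)

lemma measurable_profile [measurable]: "profile \<alpha> \<in> borel_measurable borel"
  unfolding profile_def[abs_def] by measurable

text \<open>On (0,1] the weight is at most 1. Beyond 1 the integrand is \<open>x powr e\<close>, and
  the hypothesis on \<open>q\<close> says \<open>e < -1\<close>.\<close>

lemma integrable_profile_powr:
  assumes "\<alpha> \<ge> -1/2" "(\<alpha> + 3/2) * q > 2 * \<alpha> + 2"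
  shows "integrable (mu \<alpha>) (\<lambda>x. profile \<alpha> x powr q)"
proof -
  define e where "e = (- \<alpha> - 3/2) * q + (2 * \<alpha> + 1)"
  have e: "e < -1" using assms by (simp add: e_def algebra_simps)
  have "set_integrable lborel {0<..} (\<lambda>x::real. x powr (2 * \<alpha> + 1) *\<^sub>R (profile \<alpha> x powr q))"
    unfolding set_integrable_def
  proof (rule Bochner_Integration.integrable_bound)
    show "integrable lborel (\<lambda>x::real. indicator {0..1} x + indicator {1..} x *\<^sub>R x powr e)"
      using set_integrable_powr_at_top[OF e] unfolding set_integrable_def
      by (intro Bochner_Integration.integrable_add) auto
    show "AE x in lborel. norm (indicator {0<..} x *\<^sub>R x powr (2 * \<alpha> + 1) *\<^sub>R profile \<alpha> x powr q) \<le> norm (indicator {0..1} x + indicator {1..} x *\<^sub>R x powr e)"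
    proof (rule AE_I2)
      fix x :: real
      show "norm (indicator {0<..} x *\<^sub>R x powr (2 * \<alpha> + 1) *\<^sub>R profile \<alpha> x powr q) \<le> norm (indicator {0..1} x + indicator {1..} x *\<^sub>R x powr e)"
      proof (cases "x \<le> 0 \<or> 1 < x")
        case True
        then show ?thesis
          by (auto simp: profile_def powr_powr e_def mult.commute simp flip: powr_add)
      next
        case False
        then show ?thesis using assms
          by (auto simp: profile_def indicator_def powr_le1 add_increasing2)
      qed
    qed
  qed auto
  then show ?thesis
    by (subst integrable_mu) (auto intro: measurable_muI)
qed

text \<open>The constant of \<open>phi_decay\<close> carried over to \<open>j \<alpha> n\<close>,
  with 6 = 3 * sqrt 2 * sqrt 2. By Stirling it grows like exp \<nu> up to a power of \<nu>.\<close>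

definition jbd :: "real \<Rightarrow> nat \<Rightarrow> real" where
  "jbd \<alpha> n = (let \<nu> = \<alpha> + 2 * real n + 1 in
     6 * sqrt \<nu> * (\<nu> + 1/2) powr (\<nu> + 1/2) * rGamma (\<nu> + 1))"

text \<open>The power of \<open>x\<close> in the Bessel function and the one in \<open>j\<close>
  combine to the exponent \<open>\<nu> n - \<alpha> - 1 = 2 * n\<close>.\<close>

lemma j_phi:
  assumes "\<alpha> \<ge> -1/2" "x > 0"
  defines "\<nu> n \<equiv> \<alpha> + 2 * real n + 1"
  shows "j \<alpha> n x = sqrt (2 * \<nu> n) * 2 powr (- \<nu> n) * x ^ (2 * n) * phi (\<nu> n) (x\<^sup>2 / 4)"
proof -
  have "(x / 2) powr \<nu> n * x powr (- \<alpha> - 1) = 2 powr (- \<nu> n) * x powr (\<nu> n + (- \<alpha> - 1))"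
    using assms(2) by (simp only: powr_add) (simp add: powr_divide powr_minus_divide)
  also have "\<nu> n + (- \<alpha> - 1) = real (2 * n)" by (simp add: \<nu>_def)
  finally have "(x / 2) powr \<nu> n * x powr (- \<alpha> - 1) = 2 powr (- \<nu> n) * x ^ (2 * n)"
    using powr_realpow[of x "2 * n"] assms by simp
  moreover have "j \<alpha> n x = sqrt (2 * \<nu> n) * ((x / 2) powr \<nu> n * phi (\<nu> n) (x\<^sup>2 / 4)) * x powr (- \<alpha> - 1)"
    unfolding j_def using besselJ_phi[of "\<nu> n" x] assms by (simp add: \<nu>_def algebra_simps)
  ultimately show ?thesis by (simp add: mult_ac)
qed

lemma continuous_on_j: "\<alpha> \<ge> -1/2 \<Longrightarrow> continuous_on {0<..} (j \<alpha> n)"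
proof (subst continuous_on_cong[OF refl j_phi])
  assume \<alpha>: "\<alpha> \<ge> -1/2"
  show "continuous_on {0<..} (\<lambda>x. sqrt (2 * (\<alpha> + 2 * real n + 1)) * 2 powr (- (\<alpha> + 2 * real n + 1)) * x ^ (2 * n)
      * phi (\<alpha> + 2 * real n + 1) (x\<^sup>2 / 4))"
    using \<alpha> by (intro continuous_intros) auto
qed auto

lemma j_small:
  assumes "\<alpha> \<ge> -1/2" "x > 0"
  defines "\<nu> n \<equiv> \<alpha> + 2 * real n + 1"
  shows "\<bar>j \<alpha> n x\<bar> \<le> sqrt (2 * \<nu> n) * 2 powr (- \<nu> n) * x ^ (2 * n) * rGamma (\<nu> n + 1)"
proof -
  have "\<bar>phi (\<nu> n) (x\<^sup>2 / 4)\<bar> \<le> rGamma (\<nu> n + 1)"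
    using assms by (intro phi_bound) (auto simp: \<nu>_def)
  then show ?thesis
    using assms unfolding j_phi[OF assms(1,2)] \<nu>_def[symmetric]
    by (simp add: abs_mult \<nu>_def mult_left_mono)
qed

lemma j_large:
  assumes "\<alpha> \<ge> -1/2" "x > 0"
  shows "\<bar>j \<alpha> n x\<bar> \<le> jbd \<alpha> n * x powr (- \<alpha> - 3/2)"
proof -
  define \<nu> where "\<nu> = \<alpha> + 2 * real n + 1"
  define a where "a = \<nu> + 1/2"
  have \<nu>: "\<nu> \<ge> 1/2" using assms by (simp add: \<nu>_def)
  have 1: "(x\<^sup>2 / 4) powr (a / 2) = (x / 2) powr a"
  proof -
    have "x\<^sup>2 / 4 = (x / 2) powr 2" using assms by (simp add: power2_eq_square)
    then show ?thesis by (simp only: powr_powr) simp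
  qed
  \<comment> \<open>Since \<open>a = \<nu> + 1/2\<close>, the exponent \<open>2 * n\<close> splits
    as \<open>a + (- \<alpha> - 3/2)\<close>: the first part is what \<open>phi_decay\<close>
    consumes, the second is the decay left over.\<close>
  have 2: "2 powr (- \<nu>) * x ^ (2 * n) = sqrt 2 * (x / 2) powr a * x powr (- \<alpha> - 3/2)"
  proof -
    have "2 powr (- \<nu>) = 2 powr (1/2) * 2 powr (- a)"
      by (simp add: a_def flip: powr_add)
    moreover have "x ^ (2 * n) = x powr a * x powr (- \<alpha> - 3/2)"
      using assms powr_realpow[of x "2 * n"] by (simp add: a_def \<nu>_def flip: powr_add)
    ultimately show ?thesis using assms
      by (simp add: powr_half_sqrt powr_divide powr_minus_divide)
  qed
  have "\<bar>j \<alpha> n x\<bar> = sqrt (2 * \<nu>) * (2 powr (- \<nu>) * x ^ (2 * n)) * \<bar>phi \<nu> (x\<^sup>2 / 4)\<bar>"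
    using \<nu> assms(2) by (simp add: j_phi[OF assms] \<nu>_def[symmetric] abs_mult)
  also have "\<dots> = sqrt (2 * \<nu>) * sqrt 2 * ((x / 2) powr a * \<bar>phi \<nu> (x\<^sup>2 / 4)\<bar>) * x powr (- \<alpha> - 3/2)"
    unfolding 2 by (simp add: mult_ac)
  also have "\<dots> \<le> sqrt (2 * \<nu>) * sqrt 2 * (3 * a powr a * rGamma (\<nu> + 1)) * x powr (- \<alpha> - 3/2)"
    using phi_decay[OF \<nu>, of "x\<^sup>2 / 4"] \<nu> 1 by (intro mult_right_mono mult_left_mono) (auto simp: a_def)
  also have "\<dots> = jbd \<alpha> n * x powr (- \<alpha> - 3/2)"
    by (simp add: jbd_def \<nu>_def[symmetric] a_def real_sqrt_mult)
  finally show ?thesis .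
qed

lemma jbd_nonneg: "\<alpha> \<ge> -1/2 \<Longrightarrow> 0 \<le> jbd \<alpha> n"
  using rGamma_pos[of "\<alpha> + 2 * real n + 1 + 1"] by (simp add: jbd_def Let_def)

text \<open>Near 0 the uniform bound on \<open>phi\<close> is used; \<open>jbd\<close> exceeds its
  constant because \<open>\<nu> + 1/2 \<ge> 1\<close>. Beyond 1 the decay is used. A single function
  of \<open>x\<close> thus serves all \<open>n\<close>, and only the factor depends on
  \<open>n\<close>.\<close>

lemma j_profile:
  assumes "\<alpha> \<ge> -1/2" "x > 0"
  shows "\<bar>j \<alpha> n x\<bar> \<le> jbd \<alpha> n * profile \<alpha> x"
proof (cases "x \<le> 1")
  case True
  define \<nu> where "\<nu> = \<alpha> + 2 * real n + 1"
  have \<nu>: "\<nu> \<ge> 1/2" using assms by (simp add: \<nu>_def)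
  have r: "rGamma (\<nu> + 1) > 0" using \<nu> by (intro rGamma_pos) auto
  have "\<bar>j \<alpha> n x\<bar> \<le> sqrt (2 * \<nu>) * 2 powr (- \<nu>) * x ^ (2 * n) * rGamma (\<nu> + 1)"
    using j_small[OF assms, of n] by (simp add: \<nu>_def)
  also have "\<dots> \<le> sqrt (2 * \<nu>) * 1 * 1 * rGamma (\<nu> + 1)"
  proof (intro mult_right_mono mult_mono power_le_one)
    show "2 powr (- \<nu>) \<le> 1" using powr_mono[of "-\<nu>" 0 "2::real"] \<nu> by simp
  qed (use \<nu> r True assms in auto)
  also have "\<dots> \<le> (6 * sqrt \<nu>) * (\<nu> + 1/2) powr (\<nu> + 1/2) * rGamma (\<nu> + 1)"
  proof (intro mult_right_mono)
    have "sqrt 2 \<le> 6" by (rule real_le_lsqrt) auto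
    then have "sqrt 2 * sqrt \<nu> * 1 \<le> 6 * sqrt \<nu> * (\<nu> + 1/2) powr (\<nu> + 1/2)"
      using \<nu> by (intro mult_mono ge_one_powr_ge_zero) auto
    then show "sqrt (2 * \<nu>) * 1 * 1 \<le> (6 * sqrt \<nu>) * (\<nu> + 1/2) powr (\<nu> + 1/2)"
      by (simp add: real_sqrt_mult)
  qed (use r in auto)
  finally show ?thesis using True by (simp add: profile_def jbd_def \<nu>_def[symmetric])
qed (use j_large[OF assms, of n] in \<open>simp add: profile_def\<close>)

text \<open>The coefficients are bounded by multiples of \<open>jbd\<close>. In the product, one
  reciprocal Gamma factor compensates \<open>a powr a\<close> up to exponential growth; the second
  one, from \<open>j_small\<close>, gives the superexponential decay.\<close>

lemma summable_jbd_j: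
  assumes "\<alpha> \<ge> -1/2" "x > 0"
  shows "summable (\<lambda>n. jbd \<alpha> n * \<bar>j \<alpha> n x\<bar>)"
proof -
  define \<nu> where "\<nu> n = \<alpha> + 2 * real n + 1" for n
  define a where "a n = \<nu> n + 1/2" for n
  define T where "T n = \<nu> n * (a n powr a n) * (rGamma (\<nu> n + 1))\<^sup>2 * x ^ (2 * n)" for n
  have \<nu>: "\<nu> n \<ge> 1/2" "\<nu> n \<ge> 2 * real n" for n using assms by (auto simp: \<nu>_def)
  have r: "rGamma (\<nu> n + 1) > 0" for n using \<nu>(1)[of n] by (intro rGamma_pos) auto
  have T0: "T n \<ge> 0" for n using \<nu>(1)[of n] by (simp add: T_def)
  have "summable T"
  proof (rule summable_ratio_test)
    \<comment> \<open>The constants below accumulate to 180 = 5 * 4 * 9, from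
      \<open>\<nu> + 2 \<le> 5 * \<nu>\<close>, \<open>a + 2 \<le> 2 * (\<nu> + 2)\<close> squared,
      and (1 + 2/a)^a \<le> exp 2 \<le> 9. Once \<open>20 * x \<le> \<nu> + 1\<close>, the ratio is
      therefore below 1/2.\<close>
    fix n :: nat assume n: "nat \<lceil>10 * x\<rceil> \<le> n"
    then have "10 * x \<le> real n" by linarith
    then have big: "20 * x \<le> \<nu> n + 1" using \<nu>(2)[of n] by simp
    have S: "\<nu> (Suc n) = \<nu> n + 2" "a (Suc n) = a n + 2" by (auto simp: \<nu>_def a_def)
    have a: "a n \<ge> 1" using \<nu>(1)[of n] by (simp add: a_def)
    have e: "(a n + 2) powr (a n + 2) \<le> (a n + 2)\<^sup>2 * (a n powr a n * 9)"
    proof -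
      have "a n + 2 = a n * (1 + 2 / a n)" using a by (simp add: field_simps)
      then have "(a n + 2) powr (a n) = a n powr a n * (1 + 2 / a n) powr a n"
        using a by (metis powr_mult)
      also have "(1 + 2 / a n) powr a n = exp (a n * ln (1 + 2 / a n))"
        using a add_pos_nonneg[of 1 "2 / a n"] by (simp add: powr_def)
      also have "\<dots> \<le> exp (a n * (2 / a n))"
        using a by (subst exp_le_cancel_iff, intro mult_left_mono ln_add_one_self_le_self) auto
      also have "\<dots> = (exp 1)\<^sup>2" using a by (simp add: flip: exp_double)
      also have "\<dots> \<le> 3\<^sup>2" using exp_le by (intro power_mono) auto
      finally have "(a n + 2) powr (a n) \<le> a n powr a n * 9" by (simp add: mult_left_mono)
      then have "(a n + 2)\<^sup>2 * (a n + 2) powr (a n) \<le> (a n + 2)\<^sup>2 * (a n powr a n * 9)"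
        by (rule mult_left_mono) auto
      then show ?thesis using a by (simp add: powr_add mult.commute)
    qed
    have G: "rGamma (\<nu> n + 1) = (\<nu> n + 1) * (\<nu> n + 2) * rGamma (\<nu> n + 2 + 1)"
      using rGamma_rec[of "\<nu> n + 1"] rGamma_rec[of "\<nu> n + 2"] by (simp add: add.assoc)
    define R where "R = rGamma (\<nu> n + 2 + 1)"
    have "T (Suc n) = (\<nu> n + 2) * (a n + 2) powr (a n + 2) * R\<^sup>2 * x ^ (2 * Suc n)"
      unfolding T_def S R_def ..
    also have "\<dots> \<le> (5 * \<nu> n) * ((2 * (\<nu> n + 2))\<^sup>2 * (a n powr a n * 9)) * R\<^sup>2 * x ^ (2 * Suc n)"
      using \<nu>(1)[of n] assms(2)
      by (intro mult_right_mono mult_mono order_trans[OF e] power_mono) (auto simp: a_def)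
    also have "\<dots> = \<nu> n * (a n powr a n) * (180 * x\<^sup>2) * ((\<nu> n + 2)\<^sup>2 * R\<^sup>2) * x ^ (2 * n)"
      by (simp add: power2_eq_square algebra_simps)
    also have "\<dots> \<le> \<nu> n * (a n powr a n) * (1/2 * (\<nu> n + 1)\<^sup>2) * ((\<nu> n + 2)\<^sup>2 * R\<^sup>2) * x ^ (2 * n)"
    proof (intro mult_right_mono mult_left_mono)
      have "(20 * x)\<^sup>2 \<le> (\<nu> n + 1)\<^sup>2" using big assms by (intro power_mono) auto
      then have "400 * x\<^sup>2 \<le> (\<nu> n + 1)\<^sup>2" by (simp add: power_mult_distrib)
      moreover have "0 \<le> x\<^sup>2" by simp
      ultimately show "180 * x\<^sup>2 \<le> 1/2 * (\<nu> n + 1)\<^sup>2" by linarith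
    qed (use \<nu>(1)[of n] in auto)
    also have "\<dots> = 1/2 * T n"
      unfolding T_def G R_def[symmetric] by (simp add: power_mult_distrib)
    finally show "norm (T (Suc n)) \<le> 1/2 * norm (T n)" using T0 by simp
  qed simp
  then have "summable (\<lambda>n. 12 * T n)" by (rule summable_mult)
  then show ?thesis
  proof (rule summable_comparison_test'[where N = 0])
    fix n :: nat
    have "jbd \<alpha> n * \<bar>j \<alpha> n x\<bar> \<le> jbd \<alpha> n * (sqrt (2 * \<nu> n) * 2 powr (- \<nu> n) * x ^ (2 * n) * rGamma (\<nu> n + 1))"
      using j_small[OF assms, of n] jbd_nonneg[OF assms(1)] by (intro mult_left_mono) (auto simp: \<nu>_def)
    also have "\<dots> = 6 * sqrt 2 * 2 powr (- \<nu> n) * T n"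
      using \<nu>(1)[of n] by (simp add: jbd_def Let_def T_def \<nu>_def[symmetric] a_def real_sqrt_mult power2_eq_square)
    also have "\<dots> \<le> (6 * 2) * 1 * T n"
    proof (intro mult_right_mono mult_mono)
      show "2 powr (- \<nu> n) \<le> 1" using powr_mono[of "-\<nu> n" 0 "2::real"] \<nu>(1)[of n] by simp
      show "sqrt 2 \<le> 2" by (rule real_le_lsqrt) auto
    qed (use T0 in auto)
    finally show "norm (jbd \<alpha> n * \<bar>j \<alpha> n x\<bar>) \<le> 12 * T n" using jbd_nonneg[OF assms(1)] by simp
  qed
qed

section \<open>The Hankel transform\<close>

text \<open>The kernel of \<open>hankel\<close> for positive arguments (\<open>besselJ_ker\<close>).
  In terms of \<open>phi\<close> it is bounded and continuous for all real arguments, so the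
  transform of an integrable function is bounded.\<close>

definition ker :: "real \<Rightarrow> real \<Rightarrow> real \<Rightarrow> real" where
  "ker \<alpha> x y = 2 powr (- \<alpha>) * phi \<alpha> ((x * y)\<^sup>2 / 4)"

lemma ker_commute: "ker \<alpha> x y = ker \<alpha> y x"
  by (simp add: ker_def mult.commute)

lemma besselJ_ker:
  assumes "\<alpha> \<ge> -1/2" "x > 0" "y > 0"
  shows "besselJ \<alpha> (x * y) / (x * y) powr \<alpha> = ker \<alpha> x y"
  using assms besselJ_phi[of \<alpha> "x * y"] powr_divide[of "x * y" 2 \<alpha>]
  by (simp add: ker_def powr_minus_divide)

lemma hankel_ker:
  assumes "\<alpha> \<ge> -1/2" "x > 0"
  shows "hankel \<alpha> f x = (\<integral>y. complex_of_real (ker \<alpha> x y) * f y \<partial>mu \<alpha>)"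
  unfolding hankel_def by (rule Bochner_Integration.integral_cong) (auto simp: besselJ_ker[OF assms] simp del: of_real_divide)

lemma abs_ker_le:
  assumes "\<alpha> \<ge> -1/2"
  shows "\<bar>ker \<alpha> x y\<bar> \<le> 2 powr (- \<alpha>) * rGamma (\<alpha> + 1)"
  using phi_bound[OF assms, of "(x * y)\<^sup>2 / 4"] by (simp add: ker_def abs_mult)

lemma measurable_ker:
  assumes "\<alpha> \<ge> -1/2" "f \<in> borel_measurable N" "g \<in> borel_measurable N"
  shows "(\<lambda>x. ker \<alpha> (f x) (g x)) \<in> borel_measurable N"
proof -
  have "phi \<alpha> \<in> borel_measurable borel"
    using continuous_on_phi[OF assms(1), of UNIV "\<lambda>x. x"] by (auto intro: borel_measurable_continuous_onI)
  then show ?thesis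
    unfolding ker_def using assms(2,3) by measurable
qed

lemma measurable_id_mu: "(\<lambda>x. x) \<in> borel_measurable (mu \<alpha>)"
  by (rule measurable_muI) simp

lemma integrable_ker_mult:
  fixes v :: "real \<Rightarrow> complex"
  assumes \<alpha>: "\<alpha> \<ge> -1/2" and v: "integrable (mu \<alpha>) v"
  shows "integrable (mu \<alpha>) (\<lambda>y. complex_of_real (ker \<alpha> x y) * v y)"
proof (rule Bochner_Integration.integrable_bound)
  let ?C = "2 powr (- \<alpha>) * rGamma (\<alpha> + 1)"
  show "integrable (mu \<alpha>) (\<lambda>y. ?C * norm (v y))" using v by simp
  note [measurable] = borel_measurable_integrable[OF v] measurable_ker[OF \<alpha> _ measurable_id_mu]
  show "(\<lambda>y. complex_of_real (ker \<alpha> x y) * v y) \<in> borel_measurable (mu \<alpha>)" by measurable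
  show "AE y in mu \<alpha>. norm (complex_of_real (ker \<alpha> x y) * v y) \<le> norm (?C * norm (v y))"
    using abs_ker_le[OF \<alpha>] rGamma_pos[of "\<alpha> + 1"] \<alpha>
    by (auto simp: norm_mult abs_mult intro!: mult_right_mono)
qed

lemma hankel_measurable:
  assumes \<alpha>: "\<alpha> \<ge> -1/2" and v[measurable]: "v \<in> borel_measurable (mu \<alpha>)"
  shows "hankel \<alpha> v \<in> borel_measurable (mu \<alpha>)"
proof -
  have [measurable]: "(\<lambda>z. ker \<alpha> (fst z) (snd z)) \<in> borel_measurable (mu \<alpha> \<Otimes>\<^sub>M mu \<alpha>)"
    by (rule measurable_ker[OF \<alpha>]; rule measurable_compose[OF _ measurable_id_mu]; rule measurable_fst measurable_snd)
  have "(\<lambda>x. \<integral>y. complex_of_real (ker \<alpha> x y) * v y \<partial>mu \<alpha>) \<in> borel_measurable (mu \<alpha>)"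
    by (rule mu.borel_measurable_lebesgue_integral) (simp add: split_beta')
  then show ?thesis
    by (rule measurable_cong[THEN iffD1, rotated]) (auto simp: hankel_ker[OF \<alpha>])
qed

lemma norm_hankel_le:
  assumes \<alpha>: "\<alpha> \<ge> -1/2" and v: "integrable (mu \<alpha>) v" and "x > 0"
  shows "norm (hankel \<alpha> v x) \<le> 2 powr (- \<alpha>) * rGamma (\<alpha> + 1) * (\<integral>y. norm (v y) \<partial>mu \<alpha>)"
proof -
  have "norm (hankel \<alpha> v x) \<le> (\<integral>y. norm (complex_of_real (ker \<alpha> x y) * v y) \<partial>mu \<alpha>)"
    unfolding hankel_ker[OF \<alpha> \<open>x > 0\<close>] by (rule integral_norm_bound)
  also have "\<dots> \<le> (\<integral>y. 2 powr (- \<alpha>) * rGamma (\<alpha> + 1) * norm (v y) \<partial>mu \<alpha>)"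
    using v
    by (intro integral_mono[OF integrable_norm[OF integrable_ker_mult[OF \<alpha> v]]])
      (auto simp: norm_mult intro!: mult_right_mono abs_ker_le[OF \<alpha>])
  finally show ?thesis by simp
qed

lemma integrable_hankel_mult:
  assumes \<alpha>: "\<alpha> \<ge> -1/2" and u: "integrable (mu \<alpha>) u" and v: "integrable (mu \<alpha>) v"
  shows "integrable (mu \<alpha>) (\<lambda>x. hankel \<alpha> u x * v x)"
proof (rule Bochner_Integration.integrable_bound)
  let ?C = "2 powr (- \<alpha>) * rGamma (\<alpha> + 1) * (\<integral>y. norm (u y) \<partial>mu \<alpha>)"
  show "integrable (mu \<alpha>) (\<lambda>x. ?C * norm (v x))" using v by simp
  note [measurable] = hankel_measurable[OF \<alpha> borel_measurable_integrable[OF u]] borel_measurable_integrable[OF v]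
  show "(\<lambda>x. hankel \<alpha> u x * v x) \<in> borel_measurable (mu \<alpha>)" by measurable
  have "norm (hankel \<alpha> u x * v x) \<le> ?C * norm (v x)" if "x > 0" for x
    unfolding norm_mult using norm_hankel_le[OF \<alpha> u that] by (rule mult_right_mono) simp
  then show "AE x in mu \<alpha>. norm (hankel \<alpha> u x * v x) \<le> norm (?C * norm (v x))"
    unfolding real_norm_def by (intro AE_I2 order_trans[OF _ abs_ge_self]) simp
qed

text \<open>Fubini for a bounded symmetric kernel. This takes the place of Parseval's
  identity.\<close>

lemma hankel_symmetric:
  assumes \<alpha>: "\<alpha> \<ge> -1/2" and u: "integrable (mu \<alpha>) u" and v: "integrable (mu \<alpha>) v"
  shows "(\<integral>x. hankel \<alpha> u x * v x \<partial>mu \<alpha>) = (\<integral>y. u y * hankel \<alpha> v y \<partial>mu \<alpha>)"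
proof -
  interpret pair_sigma_finite "mu \<alpha>" "mu \<alpha>" ..
  let ?f = "\<lambda>x y. complex_of_real (ker \<alpha> x y) * u y * v x"
  note [measurable] = borel_measurable_integrable[OF u] borel_measurable_integrable[OF v]
  have k[measurable]: "(\<lambda>z. ker \<alpha> (fst z) (snd z)) \<in> borel_measurable (mu \<alpha> \<Otimes>\<^sub>M mu \<alpha>)"
    by (rule measurable_ker[OF \<alpha>]; rule measurable_compose[OF _ measurable_id_mu]; rule measurable_fst measurable_snd)
  have m[measurable]: "(\<lambda>z. ?f (fst z) (snd z)) \<in> borel_measurable (mu \<alpha> \<Otimes>\<^sub>M mu \<alpha>)"
    by measurable
  have "integrable (mu \<alpha> \<Otimes>\<^sub>M mu \<alpha>) (\<lambda>z. ?f (fst z) (snd z))"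
  proof (rule Fubini_integrable[OF m])
    show "AE x in mu \<alpha>. integrable (mu \<alpha>) (\<lambda>y. ?f (fst (x, y)) (snd (x, y)))"
      using integrable_ker_mult[OF \<alpha> u] by auto
    let ?C = "2 powr (- \<alpha>) * rGamma (\<alpha> + 1) * (\<integral>y. norm (u y) \<partial>mu \<alpha>)"
    show "integrable (mu \<alpha>) (\<lambda>x. \<integral>y. norm (?f (fst (x, y)) (snd (x, y))) \<partial>mu \<alpha>)"
    proof (rule Bochner_Integration.integrable_bound)
      show "integrable (mu \<alpha>) (\<lambda>x. ?C * norm (v x))" using v by simp
      show "(\<lambda>x. \<integral>y. norm (?f (fst (x, y)) (snd (x, y))) \<partial>mu \<alpha>) \<in> borel_measurable (mu \<alpha>)"
        by (rule mu.borel_measurable_lebesgue_integral) (use m in \<open>simp add: split_beta'\<close>)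
      show "AE x in mu \<alpha>. norm (\<integral>y. norm (?f (fst (x, y)) (snd (x, y))) \<partial>mu \<alpha>) \<le> norm (?C * norm (v x))"
      proof (rule AE_I2)
        fix x assume "x \<in> space (mu \<alpha>)"
        have "(\<integral>y. norm (?f x y) \<partial>mu \<alpha>) \<le> (\<integral>y. (2 powr (- \<alpha>) * rGamma (\<alpha> + 1)) * norm (u y) * norm (v x) \<partial>mu \<alpha>)"
          using u
          by (intro integral_mono[OF integrable_norm[OF integrable_mult_left[OF integrable_ker_mult[OF \<alpha> u]]]])
            (auto simp: norm_mult intro!: mult_right_mono abs_ker_le[OF \<alpha>])
        also have "\<dots> = ?C * norm (v x)" by simp
        also have "\<dots> \<le> norm (?C * norm (v x))" by simp
        finally show "norm (\<integral>y. norm (?f (fst (x, y)) (snd (x, y))) \<partial>mu \<alpha>) \<le> norm (?C * norm (v x))"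
          by (simp add: integral_nonneg_AE)
      qed
    qed
  qed
  then have "integrable (mu \<alpha> \<Otimes>\<^sub>M mu \<alpha>) (case_prod ?f)" by (simp add: split_beta')
  then have "(\<integral>y. (\<integral>x. ?f x y \<partial>mu \<alpha>) \<partial>mu \<alpha>) = (\<integral>x. (\<integral>y. ?f x y \<partial>mu \<alpha>) \<partial>mu \<alpha>)"
    by (rule Fubini_integral)
  also have "(\<integral>x. (\<integral>y. ?f x y \<partial>mu \<alpha>) \<partial>mu \<alpha>) = (\<integral>x. hankel \<alpha> u x * v x \<partial>mu \<alpha>)"
    by (rule Bochner_Integration.integral_cong) (auto simp: hankel_ker[OF \<alpha>])
  also have "(\<integral>y. (\<integral>x. ?f x y \<partial>mu \<alpha>) \<partial>mu \<alpha>) = (\<integral>y. u y * hankel \<alpha> v y \<partial>mu \<alpha>)"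
  proof (rule Bochner_Integration.integral_cong)
    fix y assume "y \<in> space (mu \<alpha>)"
    then have y: "y > 0" by simp
    have "(\<integral>x. ?f x y \<partial>mu \<alpha>) = (\<integral>x. u y * (complex_of_real (ker \<alpha> y x) * v x) \<partial>mu \<alpha>)"
      by (simp add: ker_commute mult_ac)
    then show "(\<integral>x. ?f x y \<partial>mu \<alpha>) = u y * hankel \<alpha> v y"
      by (simp add: hankel_ker[OF \<alpha> y])
  qed simp
  finally show ?thesis by simp
qed

section \<open>Gaussians under the Hankel transform\<close>

lemma gauss_moment:
  assumes \<alpha>: "\<alpha> \<ge> -1/2" and t: "t > 0"
  shows "integrable (mu \<alpha>) (\<lambda>y. y ^ (2 * k) * exp (- (t * y\<^sup>2 / 2)))" (is "integrable _ ?g")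
    and "(\<integral>y. y ^ (2 * k) * exp (- (t * y\<^sup>2 / 2)) \<partial>mu \<alpha>) = Gamma (\<alpha> + 1 + real k) / 2 * (2 / t) powr (\<alpha> + 1 + real k)"
proof -
  \<comment> \<open>The substitution s = t y^2 / 2 turns y^(2 \<alpha> + 1 + 2 k) dy into a multiple
    of s^(b - 1) ds, so the moment is the Gamma integral at \<open>b\<close>.\<close>
  define b where "b = \<alpha> + 1 + real k"
  have b: "b > 0" using \<alpha> by (simp add: b_def)
  let ?f = "\<lambda>s::real. s powr (b - 1) / exp s"
  let ?h = "\<lambda>y::real. t * y\<^sup>2 / 2"
  let ?G = "\<lambda>y. y powr (2 * \<alpha> + 1) * ?g y"
  have "(?f has_integral Gamma b) {0..} \<longleftrightarrow> (?f has_integral Gamma b) {0<..}"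
    by (rule has_integral_spike_set_eq; rule negligible_subset[of "{0}"]) auto
  then have f: "(?f has_integral Gamma b) {0<..}"
    using Gamma_integral_real[OF b] by simp
  then have f': "?f absolutely_integrable_on {0<..}"
    by (intro nonnegative_absolutely_integrable_1) (auto simp: integrable_on_def)
  have im: "?h ` {0<..} = {0<..}"
  proof safe
    fix s :: real assume "s > 0"
    then show "s \<in> ?h ` {0<..}" using t by (intro image_eqI[of _ _ "sqrt (2 * s / t)"]) auto
  qed (use t in auto)
  have inj: "inj_on ?h {0<..}"
    using t by (auto simp: inj_on_def power2_eq_iff)
  have cv: "(\<lambda>y. \<bar>t * y\<bar> * ?f (?h y)) absolutely_integrable_on {0<..} \<and> integral {0<..} (\<lambda>y. \<bar>t * y\<bar> * ?f (?h y)) = Gamma b"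
  proof (subst has_absolute_integral_change_of_variables_1'[where g = ?h])
    show "?f absolutely_integrable_on (?h ` {0<..}) \<and> integral (?h ` {0<..}) ?f = Gamma b"
      unfolding im using f f' by (auto intro: integral_unique)
  qed (auto intro!: derivative_eq_intros inj)
  have eq: "\<bar>t * y\<bar> * ?f (?h y) = (2 * (t / 2) powr b) * ?G y" if "y \<in> {0<..}" for y
  proof -
    have "(t * y\<^sup>2 / 2) powr (b - 1) = (t / 2) powr (b - 1) * (y\<^sup>2) powr (b - 1)"
      using t by (subst powr_mult[symmetric]) auto
    also have "(t / 2) powr (b - 1) = (t / 2) powr b / (t / 2)" using t by (simp add: powr_diff)
    also have "(y\<^sup>2) powr (b - 1) = y powr (2 * \<alpha> + 2 * real k)"
    proof -
      have "y\<^sup>2 = y powr 2" using that by simp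
      then show ?thesis by (simp only: powr_powr) (simp add: b_def algebra_simps)
    qed
    also have "\<dots> = y powr (2 * \<alpha> + 1 + real (2 * k)) / y" using that by (simp add: field_simps powr_add)
    also have "\<dots> = y powr (2 * \<alpha> + 1) * y ^ (2 * k) / y"
      using that by (subst powr_add, subst powr_realpow) auto
    finally show ?thesis using that t by (simp add: exp_minus field_simps)
  qed
  have "(\<lambda>y. \<bar>t * y\<bar> * ?f (?h y)) absolutely_integrable_on {0<..}
      \<longleftrightarrow> (\<lambda>y. (2 * (t / 2) powr b) * ?G y) absolutely_integrable_on {0<..}"
    by (rule set_integrable_cong[OF refl refl]) (rule eq)
  moreover have "integral {0<..} (\<lambda>y. \<bar>t * y\<bar> * ?f (?h y)) = integral {0<..} (\<lambda>y. (2 * (t / 2) powr b) * ?G y)"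
    by (rule Henstock_Kurzweil_Integration.integral_cong) (rule eq)
  ultimately have "(\<lambda>y. (2 * (t / 2) powr b) * ?G y) absolutely_integrable_on {0<..}"
    and e: "(2 * (t / 2) powr b) * integral {0<..} ?G = Gamma b"
    using cv by simp_all
  then have G: "?G absolutely_integrable_on {0<..}"
    using t set_integrable_mult_right_iff[of "2 * (t / 2) powr b" lebesgue "{0<..}" ?G] by simp
  have G': "integral {0<..} ?G = Gamma b / (2 * (t / 2) powr b)"
    using e t by (subst nonzero_eq_divide_eq) (simp_all only: mult.commute, auto)
  have "set_integrable lborel {0<..} ?G"
    using G unfolding set_integrable_def by (subst (asm) integrable_completion) auto
  moreover have m: "?g \<in> borel_measurable (mu \<alpha>)" by (rule measurable_muI) simp
  ultimately show "integrable (mu \<alpha>) ?g" by (simp add: integrable_mu)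
  have "(\<integral>y. ?g y \<partial>mu \<alpha>) = (LINT y:{0<..}|lborel. ?G y)"
    using m by (simp add: integral_mu)
  also have "\<dots> = integral {0<..} ?G"
    by (rule set_borel_integral_eq_integral) fact
  also have "\<dots> = Gamma b / 2 * (2 / t) powr b"
    using t unfolding G' by (simp add: powr_divide field_simps)
  finally show "(\<integral>y. ?g y \<partial>mu \<alpha>) = Gamma (\<alpha> + 1 + real k) / 2 * (2 / t) powr (\<alpha> + 1 + real k)"
    by (simp add: b_def)
qed

lemma integrable_gauss:
  assumes "\<alpha> \<ge> -1/2" "t > 0"
  shows "integrable (mu \<alpha>) (\<lambda>y. exp (- (t * y\<^sup>2 / 2)))"
  using gauss_moment(1)[OF assms, of 0] by simp

text \<open>The series of the kernel is integrated term by term. The Gamma value in each moment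
  cancels the reciprocal Gamma coefficient, and what remains is an exponential series.\<close>

lemma hankel_gauss:
  assumes \<alpha>: "\<alpha> \<ge> -1/2" and t: "t > 0" and x: "x > 0"
  shows "hankel \<alpha> (\<lambda>y. complex_of_real (exp (- (t * y\<^sup>2 / 2)))) x
    = complex_of_real (t powr (- \<alpha> - 1) * exp (- (x\<^sup>2 / (2 * t))))"
proof -
  define c where "c k = 2 powr (- \<alpha>) * (rGamma (\<alpha> + real k + 1) / fact k * (x\<^sup>2 / 4) ^ k)" for k
  let ?g = "\<lambda>k y. y ^ (2 * k) * exp (- (t * y\<^sup>2 / 2))"
  let ?f = "\<lambda>k y. (-1) ^ k * c k * ?g k y"
  let ?q = "t powr (- \<alpha> - 1)"
  have c0: "c k \<ge> 0" for k
    using less_imp_le[OF rGamma_pos[of "\<alpha> + real k + 1"]] \<alpha> by (simp add: c_def)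
  have cm: "c k * (\<integral>y. ?g k y \<partial>mu \<alpha>) = ?q * ((x\<^sup>2 / (2 * t)) ^ k / fact k)" for k
  proof -
    have "rGamma (\<alpha> + real k + 1) * Gamma (\<alpha> + 1 + real k) = 1"
    proof -
      have "\<alpha> + 1 + real k = \<alpha> + real k + 1" by simp
      then show ?thesis
        using less_imp_neq[OF Gamma_real_pos[of "\<alpha> + real k + 1"]] \<alpha>
        by (simp only:) (simp add: rGamma_inverse_Gamma)
    qed
    moreover have "2 powr (- \<alpha>) * (2 / t) powr (\<alpha> + 1 + real k) / 2 = ?q * (2 / t) ^ k"
      using t by (simp add: powr_add powr_realpow powr_divide powr_diff powr_minus_divide power_divide)
    moreover have "(x\<^sup>2 / 4) ^ k * (2 / t) ^ k = (x\<^sup>2 / (2 * t)) ^ k"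
      by (simp flip: power_mult_distrib)
    moreover have "c k * (\<integral>y. ?g k y \<partial>mu \<alpha>) = (rGamma (\<alpha> + real k + 1) * Gamma (\<alpha> + 1 + real k))
       * (2 powr (- \<alpha>) * (2 / t) powr (\<alpha> + 1 + real k) / 2) * (x\<^sup>2 / 4) ^ k / fact k"
      unfolding gauss_moment(2)[OF \<alpha> t] c_def by (simp add: mult_ac)
    ultimately show ?thesis by (simp add: mult_ac)
  qed
  have S: "(\<lambda>k. ?f k y) sums (ker \<alpha> x y * exp (- (t * y\<^sup>2 / 2)))" for y
  proof -
    have "(\<lambda>k. 2 powr (- \<alpha>) * ((-1) ^ k * rGamma (\<alpha> + real k + 1) / fact k * ((x * y)\<^sup>2 / 4) ^ k) * exp (- (t * y\<^sup>2 / 2)))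
       sums (ker \<alpha> x y * exp (- (t * y\<^sup>2 / 2)))"
      unfolding ker_def phi_def by (intro sums_mult2 sums_mult summable_sums summable_phi[OF \<alpha>])
    then show ?thesis
      by (simp add: c_def power_mult_distrib power_divide mult_ac flip: power_mult)
  qed
  have i: "integrable (mu \<alpha>) (?f k)" for k
    using gauss_moment(1)[OF \<alpha> t, of k] by (simp add: mult.assoc)
  have n: "norm (?f k y) = c k * ?g k y" for k y using c0[of k] by (simp add: abs_mult)
  have "(\<lambda>k. \<integral>y. ?f k y \<partial>mu \<alpha>) sums (\<integral>y. (\<Sum>k. ?f k y) \<partial>mu \<alpha>)"
  proof (rule sums_integral[OF i])
    have "summable (\<lambda>k. c k * ?g k y)" for y
    proof -
      \<comment> \<open>A power series converges absolutely at points of strictly smaller modulus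
        than a point of convergence; the \<open>+ 1\<close> keeps the comparison strict when
        \<open>x * y\<close> is 0.\<close>
      have "summable (\<lambda>k. 2 powr (- \<alpha>) * norm ((-1) ^ k * rGamma (\<alpha> + real k + 1) / fact k * (- (x * y)\<^sup>2 / 4) ^ k) * exp (- (t * y\<^sup>2 / 2)))"
      proof (intro summable_mult summable_mult2)
        show "summable (\<lambda>k. norm ((-1) ^ k * rGamma (\<alpha> + real k + 1) / fact k * (- (x * y)\<^sup>2 / 4) ^ k))"
          by (rule powser_insidea[OF summable_phi[OF \<alpha>, of "(x * y)\<^sup>2 + 1"]]) (simp add: add_nonneg_pos)
      qed
      then show ?thesis
        using less_imp_le[OF rGamma_pos] \<alpha>
        by (simp add: c_def power_mult_distrib power_divide mult_ac abs_mult power_abs flip: power_mult)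
    qed
    then show "AE y in mu \<alpha>. summable (\<lambda>k. norm (?f k y))" unfolding n by simp
    have "summable (\<lambda>k. ?q * ((x\<^sup>2 / (2 * t)) ^ k / fact k))"
      using summable_exp[of "x\<^sup>2 / (2 * t)"] by (intro summable_mult) (simp add: field_simps)
    then show "summable (\<lambda>k. \<integral>y. norm (?f k y) \<partial>mu \<alpha>)"
      unfolding n by (simp add: cm)
  qed
  moreover have "(\<integral>y. ?f k y \<partial>mu \<alpha>) = ?q * ((- (x\<^sup>2 / (2 * t))) ^ k / fact k)" for k
  proof -
    have "(\<integral>y. ?f k y \<partial>mu \<alpha>) = (-1) ^ k * (c k * (\<integral>y. ?g k y \<partial>mu \<alpha>))" by (simp add: mult.assoc)
    then show ?thesis unfolding cm power_minus[of "x\<^sup>2 / (2 * t)"] by simp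
  qed
  moreover have "(\<lambda>k. ?q * ((- (x\<^sup>2 / (2 * t))) ^ k / fact k)) sums (?q * exp (- (x\<^sup>2 / (2 * t))))"
    using exp_converges[of "- (x\<^sup>2 / (2 * t))"] by (intro sums_mult) (simp add: field_simps)
  ultimately have "(\<integral>y. (\<Sum>k. ?f k y) \<partial>mu \<alpha>) = ?q * exp (- (x\<^sup>2 / (2 * t)))"
    using sums_unique2 by auto
  then have "(\<integral>y. ker \<alpha> x y * exp (- (t * y\<^sup>2 / 2)) \<partial>mu \<alpha>) = ?q * exp (- (x\<^sup>2 / (2 * t)))"
    using sums_unique[OF S] by simp
  moreover have "hankel \<alpha> (\<lambda>y. complex_of_real (exp (- (t * y\<^sup>2 / 2)))) x
     = complex_of_real (\<integral>y. ker \<alpha> x y * exp (- (t * y\<^sup>2 / 2)) \<partial>mu \<alpha>)"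
    unfolding hankel_ker[OF \<alpha> x] by (simp flip: integral_complex_of_real)
  ultimately show ?thesis by simp
qed

section \<open>The kernel expansion\<close>

text \<open>The derivative of \<open>2 \<nu> J\<^sub>\<nu>(x t) J\<^sub>\<nu>(y t)\<close> in \<open>t\<close> is a difference of the integrands at
  \<open>\<nu> - 1\<close> and \<open>\<nu> + 1\<close>, so that summing over \<open>\<nu> = \<alpha> + 2 m + 1\<close> telescopes.\<close>

lemma phi_product_integral:
  fixes x y :: real
  assumes \<alpha>: "\<alpha> \<ge> -1/2"
  defines "X \<equiv> (\<lambda>t. (x * t)\<^sup>2 / 4)" and "Y \<equiv> (\<lambda>t. (y * t)\<^sup>2 / 4)"
  defines "q \<equiv> (\<lambda>m t. indicator {0..1} t * t ^ (4 * m) * phi (\<alpha> + 2 * real m) (X t) * phi (\<alpha> + 2 * real m) (Y t))"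
  shows "integrable (mu \<alpha>) (q m)"
    and "\<bar>\<integral>t. q m t \<partial>mu \<alpha>\<bar> \<le> (rGamma (\<alpha> + 2 * real m + 1))\<^sup>2 * (\<integral>t. indicator {0..1} t \<partial>mu \<alpha>)"
    and "4 * ((\<integral>t. q m t \<partial>mu \<alpha>) - ((x * y / 4)\<^sup>2) * (\<integral>t. q (Suc m) t \<partial>mu \<alpha>))
       = 2 * (\<alpha> + 2 * real m + 1) * phi (\<alpha> + 2 * real m + 1) (x\<^sup>2 / 4) * phi (\<alpha> + 2 * real m + 1) (y\<^sup>2 / 4)"
proof -
  have XY: "X t \<ge> 0" "Y t \<ge> 0" for t by (auto simp: X_def Y_def)
  have cont: "continuous_on A X" "continuous_on A Y" for A
    by (auto simp: X_def Y_def intro!: continuous_intros)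
  have cphi: "continuous_on A (\<lambda>t. phi \<nu> (X t))" "continuous_on A (\<lambda>t. phi \<nu> (Y t))" if "\<nu> \<ge> -1/2" for \<nu> A
    using that by (auto intro!: continuous_intros cont)
  have qb: "\<bar>q m t\<bar> \<le> (rGamma (\<alpha> + 2 * real m + 1))\<^sup>2 * indicator {0..1} t" for m t
  proof (cases "t \<in> {0..1}")
    case True
    let ?r = "rGamma (\<alpha> + 2 * real m + 1)"
    have "t ^ (4 * m) * \<bar>phi (\<alpha> + 2 * real m) (X t)\<bar> * \<bar>phi (\<alpha> + 2 * real m) (Y t)\<bar> \<le> 1 * ?r * ?r"
      using True \<alpha> less_imp_le[OF rGamma_pos[of "\<alpha> + 2 * real m + 1"]]
      by (intro mult_mono power_le_one phi_bound XY) auto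
    then show ?thesis using True by (simp add: q_def abs_mult power2_eq_square)
  qed (simp add: q_def)
  have qm: "q m \<in> borel_measurable borel" for m
  proof -
    have [measurable]: "(\<lambda>t. phi (\<alpha> + 2 * real m) (X t)) \<in> borel_measurable borel"
      "(\<lambda>t. phi (\<alpha> + 2 * real m) (Y t)) \<in> borel_measurable borel"
      using \<alpha> by (auto intro!: borel_measurable_continuous_onI cphi)
    show ?thesis unfolding q_def by measurable
  qed
  show qi: "integrable (mu \<alpha>) (q m)" for m
  proof (rule Bochner_Integration.integrable_bound)
    show "integrable (mu \<alpha>) (\<lambda>t. (rGamma (\<alpha> + 2 * real m + 1))\<^sup>2 * indicator {0..1} t)"
      using integrable_mu_Icc[OF \<alpha>, of 1] by simp
    show "AE t in mu \<alpha>. norm (q m t) \<le> norm ((rGamma (\<alpha> + 2 * real m + 1))\<^sup>2 * indicator {0..1} t)"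
      using qb[of m] by auto
  qed (intro measurable_muI qm)
  have "\<bar>\<integral>t. q m t \<partial>mu \<alpha>\<bar> \<le> (\<integral>t. \<bar>q m t\<bar> \<partial>mu \<alpha>)"
    using integral_norm_bound[of "mu \<alpha>" "q m"] by simp
  also have "\<dots> \<le> (\<integral>t. (rGamma (\<alpha> + 2 * real m + 1))\<^sup>2 * indicator {0..1} t \<partial>mu \<alpha>)"
    using qi[of m] integrable_mu_Icc[OF \<alpha>, of 1] by (intro integral_mono qb) auto
  finally show "\<bar>\<integral>t. q m t \<partial>mu \<alpha>\<bar> \<le> (rGamma (\<alpha> + 2 * real m + 1))\<^sup>2 * (\<integral>t. indicator {0..1} t \<partial>mu \<alpha>)"
    by simp
  define \<nu> where "\<nu> = \<alpha> + 2 * real m + 1"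
  define c where "c = (x * y / 4)\<^sup>2"
  \<comment> \<open>\<open>F\<close> is 2 \<nu> J_\<nu>(x t) J_\<nu>(y t) without its factor (x y /
    4)^\<nu>. The orders \<nu> - 1 and \<nu> + 1 belong to \<open>q m\<close> and
    \<open>q (Suc m)\<close>; their stripped factors differ by \<open>c\<close>. The density of
    \<open>mu\<close> is part of \<open>h\<close>, so that Lebesgue integration applies.\<close>
  define F where "F = (\<lambda>t. 2 * \<nu> * t powr (2 * \<nu>) * phi \<nu> (X t) * phi \<nu> (Y t))"
  define h where "h = (\<lambda>t. t powr (2 * \<alpha> + 1) * (4 * (q m t - c * q (Suc m) t)))"
  have \<nu>: "\<nu> \<ge> 1/2" using \<alpha> by (simp add: \<nu>_def)
  have D: "(F has_real_derivative h t) (at t)" if t: "t \<in> {0<..<1}" for t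
  proof -
    have tp: "t > 0" using t by simp
    let ?au = "phi \<nu> (X t)" and ?bu = "phi \<nu> (Y t)" and ?aw = "phi (\<nu> + 1) (X t)" and ?bw = "phi (\<nu> + 1) (Y t)"
      and ?av = "phi (\<nu> - 1) (X t)" and ?bv = "phi (\<nu> - 1) (Y t)"
    have dX: "((\<lambda>t. phi \<nu> (X t)) has_real_derivative - ?aw * (x\<^sup>2 * t / 2)) (at t)"
      using \<nu> by (intro DERIV_chain2[OF phi_deriv]) (auto simp: X_def power_mult_distrib intro!: derivative_eq_intros)
    have dY: "((\<lambda>t. phi \<nu> (Y t)) has_real_derivative - ?bw * (y\<^sup>2 * t / 2)) (at t)"
      using \<nu> by (intro DERIV_chain2[OF phi_deriv]) (auto simp: Y_def power_mult_distrib intro!: derivative_eq_intros)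
    have dp: "((\<lambda>t. 2 * \<nu> * t powr (2 * \<nu>)) has_real_derivative 2 * \<nu> * (2 * \<nu> * t powr (2 * \<nu> - 1))) (at t)"
      by (intro DERIV_cmult has_real_derivative_powr tp)
    have ra: "X t * ?aw = \<nu> * ?au - ?av" and rb: "Y t * ?bw = \<nu> * ?bu - ?bv"
      using phi_rec[of "\<nu> - 1" "X t"] phi_rec[of "\<nu> - 1" "Y t"] \<nu> by (auto simp: add.commute)
    have "(F has_real_derivative
       (2 * \<nu> * (2 * \<nu> * t powr (2 * \<nu> - 1)) * ?au + - ?aw * (x\<^sup>2 * t / 2) * (2 * \<nu> * t powr (2 * \<nu>))) * ?bu
        + - ?bw * (y\<^sup>2 * t / 2) * (2 * \<nu> * t powr (2 * \<nu>) * ?au)) (at t)"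
      unfolding F_def by (rule DERIV_mult[OF DERIV_mult[OF dp dX] dY])
    also have "t powr (2 * \<nu>) = t * t powr (2 * \<nu> - 1)" using tp by (simp add: powr_diff)
    also have "(2 * \<nu> * (2 * \<nu> * t powr (2 * \<nu> - 1)) * ?au + - ?aw * (x\<^sup>2 * t / 2) * (2 * \<nu> * (t * t powr (2 * \<nu> - 1)))) * ?bu
        + - ?bw * (y\<^sup>2 * t / 2) * (2 * \<nu> * (t * t powr (2 * \<nu> - 1)) * ?au)
        = 4 * t powr (2 * \<nu> - 1) * ((\<nu> * ?au) * (\<nu> * ?bu) - (X t * ?aw) * (\<nu> * ?bu) - (\<nu> * ?au) * (Y t * ?bw))"
      unfolding X_def Y_def by (simp add: field_simps power2_eq_square)
    \<comment> \<open>With A and B for the left sides of \<open>ra\<close> and \<open>rb\<close>,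
      the bracket is (\<nu> u - A) (\<nu> u' - B) - A B, where u and u' are \<open>?au\<close> and
      \<open>?bu\<close>; the two differences are \<open>?av\<close> and \<open>?bv\<close>.\<close>
    also have "\<dots> = 4 * t powr (2 * \<nu> - 1) * (?av * ?bv - X t * Y t * ?aw * ?bw)"
      using ra rb by algebra
    also have "X t * Y t = c * t ^ 4"
      unfolding X_def Y_def c_def by (simp add: power_mult_distrib power_divide power2_eq_square power4_eq_xxxx)
    also have "t powr (2 * \<nu> - 1) = t powr (2 * \<alpha> + 1) * t ^ (4 * m)"
    proof -
      have "2 * \<nu> - 1 = 2 * \<alpha> + 1 + real (4 * m)" by (simp add: \<nu>_def)
      then show ?thesis using powr_realpow[OF tp, of "4 * m"] by (simp only: powr_add)
    qed
    also have "4 * (t powr (2 * \<alpha> + 1) * t ^ (4 * m)) * (?av * ?bv - c * t ^ 4 * ?aw * ?bw) = h t"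
      using t by (simp add: h_def q_def \<nu>_def algebra_simps power_add)
    finally show ?thesis .
  qed
  have hi: "set_integrable lborel {0<..} h"
  proof -
    have i: "integrable (mu \<alpha>) (\<lambda>t. 4 * (q m t - c * q (Suc m) t))"
      using qi by simp
    show ?thesis
      using iffD1[OF integrable_mu[OF borel_measurable_integrable[OF i]] i] by (simp add: h_def)
  qed
  have "4 * ((\<integral>t. q m t \<partial>mu \<alpha>) - c * (\<integral>t. q (Suc m) t \<partial>mu \<alpha>)) = (\<integral>t. 4 * (q m t - c * q (Suc m) t) \<partial>mu \<alpha>)"
    using qi by simp
  also have "\<dots> = (LINT t:{0<..}|lborel. h t)"
    using integral_mu[OF borel_measurable_integrable[of "mu \<alpha>" "\<lambda>t. 4 * (q m t - c * q (Suc m) t)"]] qi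
    by (simp add: h_def)
  also have "\<dots> = integral {0<..} h"
    by (rule set_borel_integral_eq_integral(2)[OF hi])
  also have "\<dots> = F 1 - F 0"
  proof (rule integral_unique)
    have "(h has_integral F 1 - F 0) {0..1}"
    proof (rule fundamental_theorem_of_calculus_interior)
      show "continuous_on {0..1} F"
        unfolding F_def using \<nu>
        by (intro continuous_on_mult cphi continuous_on_const continuous_on_powr') (auto intro!: continuous_intros)
    qed (use D in \<open>auto simp: has_real_derivative_iff_has_vector_derivative\<close>)
    \<comment> \<open>The indicator in \<open>q\<close> makes \<open>h\<close> vanish beyond 1. It
      also jumps at 1, which is why the fundamental theorem is applied with derivatives in the
      interior only.\<close>
    moreover have "(h has_integral F 1 - F 0) {0..1} \<longleftrightarrow> (h has_integral F 1 - F 0) {0<..}"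
      by (rule has_integral_spike_set_eq; rule negligible_subset[of "{0}"]) (auto simp: h_def q_def)
    ultimately show "(h has_integral F 1 - F 0) {0<..}" by simp
  qed
  also have "\<dots> = 2 * \<nu> * phi \<nu> (x\<^sup>2 / 4) * phi \<nu> (y\<^sup>2 / 4)"
    using \<nu> by (simp add: F_def X_def Y_def)
  finally show "4 * ((\<integral>t. q m t \<partial>mu \<alpha>) - ((x * y / 4)\<^sup>2) * (\<integral>t. q (Suc m) t \<partial>mu \<alpha>))
       = 2 * (\<alpha> + 2 * real m + 1) * phi (\<alpha> + 2 * real m + 1) (x\<^sup>2 / 4) * phi (\<alpha> + 2 * real m + 1) (y\<^sup>2 / 4)"
    by (simp add: c_def \<nu>_def)
qed

text \<open>By \<open>phi_product_integral\<close> each product is a difference of consecutive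
  values of \<open>c ^ m * R m\<close>, where the power of \<open>c\<close> restores the stripped
  factors in x and y. The remainder vanishes by the factorial in
  \<open>rGamma_growth\<close>.\<close>

lemma j_kernel_sums:
  assumes \<alpha>: "\<alpha> \<ge> -1/2" and x: "x > 0" and y: "y > 0"
  shows "(\<lambda>n. j \<alpha> n x * j \<alpha> n y) sums (\<integral>t. indicator {0..1} t * ker \<alpha> x t * ker \<alpha> y t \<partial>mu \<alpha>)"
proof -
  define q where "q = (\<lambda>m t. indicator {0..1} t * t ^ (4 * m) * phi (\<alpha> + 2 * real m) ((x * t)\<^sup>2 / 4)
      * phi (\<alpha> + 2 * real m) ((y * t)\<^sup>2 / 4))"
  define R where "R m = (\<integral>t. q m t \<partial>mu \<alpha>)" for m
  define c where "c = (x * y / 4)\<^sup>2"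
  define I :: real where "I = (\<integral>t. indicator {0..1} t \<partial>mu \<alpha>)"
  note q = phi_product_integral[OF \<alpha>, where x = x and y = y]
  let ?k = "2 powr (- 2 * \<alpha>)"
  have tm: "j \<alpha> n x * j \<alpha> n y = ?k * (c ^ n * R n - c ^ Suc n * R (Suc n))" for n
  proof -
    define \<nu> where "\<nu> = \<alpha> + 2 * real n + 1"
    have \<nu>: "\<nu> \<ge> 1/2" using \<alpha> by (simp add: \<nu>_def)
    let ?p = "phi \<nu> (x\<^sup>2 / 4) * phi \<nu> (y\<^sup>2 / 4)"
    have "4 * (R n - c * R (Suc n)) = 2 * \<nu> * phi \<nu> (x\<^sup>2 / 4) * phi \<nu> (y\<^sup>2 / 4)"
      unfolding R_def q_def c_def \<nu>_def by (rule q(3))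
    then have 1: "R n - c * R (Suc n) = \<nu> / 2 * ?p" by simp
    have 2: "2 powr (- \<nu>) * 2 powr (- \<nu>) = ?k / 4 * inverse (16 ^ n)"
    proof -
      have "- \<nu> + - \<nu> = - 2 * \<alpha> + - real (4 * n) + - 2" by (simp add: \<nu>_def)
      then have "2 powr (- \<nu>) * 2 powr (- \<nu>) = 2 powr (- 2 * \<alpha> + - real (4 * n) + - 2)"
        by (simp only: powr_add[symmetric])
      also have "\<dots> = ?k * inverse (2 ^ (4 * n)) * (1 / 4)"
        unfolding powr_add powr_minus[of 2 "real (4 * n)"] by (simp only: powr_realpow) (simp add: powr_minus)
      finally show ?thesis by (simp add: power_mult)
    qed
    have "j \<alpha> n x * j \<alpha> n y = (2 * \<nu>) * (2 powr (- \<nu>) * 2 powr (- \<nu>)) * (x ^ (2 * n) * y ^ (2 * n)) * ?p"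
      using \<nu> by (simp add: j_phi[OF \<alpha> x] j_phi[OF \<alpha> y] \<nu>_def[symmetric])
    also have "\<dots> = ?k * (x ^ (2 * n) * y ^ (2 * n) * inverse (16 ^ n)) * (\<nu> / 2 * ?p)"
      unfolding 2 by simp
    also have "x ^ (2 * n) * y ^ (2 * n) * inverse (16 ^ n) = c ^ n"
    proof -
      have "c = x\<^sup>2 * y\<^sup>2 * inverse 16"
        by (simp add: c_def power_divide power_mult_distrib field_simps)
      then show ?thesis by (simp only: power_mult power_mult_distrib power_inverse)
    qed
    finally show ?thesis unfolding 1[symmetric] by (simp add: algebra_simps)
  qed
  have "(\<lambda>m. c ^ m * R m) \<longlonglongrightarrow> 0"
  proof (rule Lim_null_comparison)
    let ?g = "(rGamma (\<alpha> + 1))\<^sup>2 * I"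
    have c: "c \<ge> 0" and I: "I \<ge> 0" by (simp_all add: c_def I_def integral_nonneg_AE)
    show "\<forall>\<^sub>F m in sequentially. norm (c ^ m * R m) \<le> inverse (fact m) * (16 * c) ^ m * ?g"
    proof (rule always_eventually, rule allI)
      fix m
      have "rGamma (\<alpha> + real (2 * m) + 1) \<le> 2 ^ (2 * m) / fact (2 * m) * rGamma (\<alpha> + 1)"
        by (rule rGamma_growth[OF \<alpha>])
      then have "(rGamma (\<alpha> + 2 * real m + 1))\<^sup>2 \<le> (2 ^ (2 * m) / fact (2 * m) * rGamma (\<alpha> + 1))\<^sup>2"
        using \<alpha> by (intro power_mono less_imp_le[OF rGamma_pos]) auto
      also have "\<dots> = 16 ^ m / (fact (2 * m))\<^sup>2 * (rGamma (\<alpha> + 1))\<^sup>2"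
        by (simp add: power_mult_distrib power_divide flip: power_mult) (simp add: power_mult)
      also have "\<dots> \<le> 16 ^ m / fact m * (rGamma (\<alpha> + 1))\<^sup>2"
      proof (intro mult_right_mono divide_left_mono)
        have "(fact m :: real) * 1 \<le> fact (2 * m) * fact (2 * m)"
          by (intro mult_mono fact_mono) (auto simp: fact_ge_1)
        then show "(fact m :: real) \<le> (fact (2 * m))\<^sup>2" by (simp add: power2_eq_square)
      qed auto
      finally have "(rGamma (\<alpha> + 2 * real m + 1))\<^sup>2 * I \<le> 16 ^ m / fact m * (rGamma (\<alpha> + 1))\<^sup>2 * I"
        using I by (rule mult_right_mono)
      then have "\<bar>R m\<bar> \<le> 16 ^ m / fact m * (rGamma (\<alpha> + 1))\<^sup>2 * I"
        using q(2)[of m] by (simp add: R_def q_def I_def)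
      then have "c ^ m * \<bar>R m\<bar> \<le> c ^ m * (16 ^ m / fact m * (rGamma (\<alpha> + 1))\<^sup>2 * I)"
        using c by (intro mult_left_mono) auto
      then show "norm (c ^ m * R m) \<le> inverse (fact m) * (16 * c) ^ m * ?g"
        using c by (simp add: abs_mult power_mult_distrib field_simps)
    qed
    show "(\<lambda>m. inverse (fact m) * (16 * c) ^ m * ?g) \<longlonglongrightarrow> 0"
      using summable_LIMSEQ_zero[OF summable_mult2[OF summable_exp[of "16 * c"], of ?g]] by simp
  qed
  then have "(\<lambda>n. c ^ n * R n - c ^ Suc n * R (Suc n)) sums (c ^ 0 * R 0 - 0)"
    by (rule telescope_sums')
  then have "(\<lambda>n. ?k * (c ^ n * R n - c ^ Suc n * R (Suc n))) sums (?k * R 0)"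
    by (intro sums_mult) simp
  moreover have "?k * R 0 = (\<integral>t. indicator {0..1} t * ker \<alpha> x t * ker \<alpha> y t \<partial>mu \<alpha>)"
  proof -
    have "?k = 2 powr (- \<alpha>) * 2 powr (- \<alpha>)" by (simp flip: powr_add)
    then have "?k * q 0 t = indicator {0..1} t * ker \<alpha> x t * ker \<alpha> y t" for t
      by (simp add: q_def ker_def)
    then show ?thesis by (simp add: R_def flip: integral_mult_right_zero)
  qed
  ultimately show ?thesis by (simp add: tm)
qed

section \<open>Uniqueness for the Gaussian transform\<close>

text \<open>Dynkin's argument on the intersection-stable generator of open half-lines. The
  complement step needs the vanishing of the total integral, since the whole line is not a
  half-line.\<close>

lemma integral_indicator_eq_0_borel:
  fixes H :: "real \<Rightarrow> 'b::{banach, second_countable_topology}"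
  assumes sets: "\<And>A. A \<in> sets borel \<Longrightarrow> A \<inter> space M \<in> sets M" and H: "integrable M H"
    and total: "(\<integral>x. H x \<partial>M) = 0"
    and half: "\<And>b. (\<integral>x. indicator {..<b} x *\<^sub>R H x \<partial>M) = 0"
    and A: "A \<in> sets borel"
  shows "(\<integral>x. indicator A x *\<^sub>R H x \<partial>M) = 0"
proof -
  have i: "integrable M (\<lambda>x. indicator A x *\<^sub>R H x)" if "A \<in> sets borel" for A
  proof (rule Bochner_Integration.integrable_bound[OF H])
    have "(indicator A :: real \<Rightarrow> real) \<in> borel_measurable M"
      using sets[OF that] by (simp add: borel_measurable_indicator_iff)
    then show "(\<lambda>x. indicator A x *\<^sub>R H x) \<in> borel_measurable M"
      using borel_measurable_integrable[OF H] by measurable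
  qed (auto simp: indicator_def)
  have Int_st: "Int_stable (range lessThan :: real set set)"
  proof (unfold Int_stable_def, safe)
    fix a b :: real
    show "{..<a} \<inter> {..<b} \<in> range lessThan" by (rule range_eqI[of _ _ "min a b"]) auto
  qed
  have eq: "sets borel = sigma_sets UNIV (range lessThan :: real set set)"
    by (subst borel_Iio) simp
  have "range lessThan \<subseteq> Pow (UNIV :: real set)" by simp
  note Int_st this
  moreover have "A \<in> sigma_sets UNIV (range lessThan)" using A eq by simp
  ultimately show ?thesis
  proof (induction rule: sigma_sets_induct_disjoint[where \<Omega> = UNIV])
    case (compl A)
    have A: "A \<in> sets borel" using compl eq by simp
    have "(\<integral>x. indicator (UNIV - A) x *\<^sub>R H x \<partial>M) = (\<integral>x. H x - indicator A x *\<^sub>R H x \<partial>M)"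
      by (rule Bochner_Integration.integral_cong) (auto simp: indicator_def)
    also have "\<dots> = 0" using H i[OF A] total compl by simp
    finally show ?case .
  next
    case (union A)
    have A: "A i \<in> sets borel" for i using union(2) eq by auto
    have eqI: "(\<integral>x. indicator B x *\<^sub>R H x \<partial>M) = (LINT x:B \<inter> space M|M. H x)" for B
      unfolding set_lebesgue_integral_def
      by (rule Bochner_Integration.integral_cong) (auto simp: indicator_def)
    have U: "(\<Union>i. A i) \<inter> space M = (\<Union>i. A i \<inter> space M)" by auto
    have "(LINT x:(\<Union>i. A i \<inter> space M)|M. H x) = (\<Sum>i. (LINT x:A i \<inter> space M|M. H x))"
    proof (rule lebesgue_integral_countable_add)
      show "set_integrable M (\<Union>i. A i \<inter> space M) H"
        unfolding set_integrable_def
        by (intro integrable_mult_indicator[OF _ H] sets.countable_UN) (use sets[OF A] in auto)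
    qed (use sets[OF A] union(1) in \<open>auto simp: disjoint_family_on_def\<close>)
    moreover have "(LINT x:A i \<inter> space M|M. H x) = 0" for i
      using union(3)[of i] by (simp only: eqI)
    ultimately show ?case
      unfolding eqI U by simp
  qed (use half in auto)
qed

text \<open>For s = exp(-x^2/2) the Gaussian with t = n + 1 is s * s^n. So the finite function
  \<open>H = h * s\<close> is orthogonal to all polynomials in s, by Weierstrass on [0,1] to all
  continuous functions of s, and in the limit to indicators of half-lines, because s decreases on
  the positive axis. Asking integrability only against Gaussians admits sums of bounded and square
  integrable functions.\<close>

lemma gauss_transform_unique:
  fixes h :: "real \<Rightarrow> complex"
  assumes int: "\<And>t. t > 0 \<Longrightarrow> integrable (mu \<alpha>) (\<lambda>x. h x * complex_of_real (exp (- (t * x\<^sup>2 / 2))))"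
    and zero: "\<And>t. t > 0 \<Longrightarrow> (\<integral>x. h x * complex_of_real (exp (- (t * x\<^sup>2 / 2))) \<partial>mu \<alpha>) = 0"
  shows "AE x in mu \<alpha>. h x = 0"
proof -
  define s where "s x = exp (- (x\<^sup>2 / 2))" for x :: real
  define H where "H x = h x * complex_of_real (s x)" for x
  have s: "0 < s x" "s x \<le> 1" for x by (auto simp: s_def)
  have sm[measurable]: "s \<in> borel_measurable (mu \<alpha>)"
    unfolding s_def by (rule measurable_muI) simp
  have H: "integrable (mu \<alpha>) H" using int[of 1] by (simp add: H_def[abs_def] s_def)
  note [measurable] = borel_measurable_integrable[OF H]
  have pw: "H x * complex_of_real (s x) ^ n = h x * complex_of_real (exp (- ((real n + 1) * x\<^sup>2 / 2)))" for n x
  proof -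
    have "s x * s x ^ n = exp (- (x\<^sup>2 / 2) + real n * (- (x\<^sup>2 / 2)))"
      by (simp only: s_def exp_add exp_of_nat_mult)
    also have "- (x\<^sup>2 / 2) + real n * (- (x\<^sup>2 / 2)) = - ((real n + 1) * x\<^sup>2 / 2)" by (simp add: field_simps)
    finally show ?thesis by (simp add: H_def mult.assoc flip: of_real_power of_real_mult)
  qed
  have bounded_int: "integrable (mu \<alpha>) (\<lambda>x. H x * complex_of_real (g x))"
    if "g \<in> borel_measurable (mu \<alpha>)" "\<And>x. \<bar>g x\<bar> \<le> C" for g C
  proof (rule Bochner_Integration.integrable_bound)
    show "integrable (mu \<alpha>) (\<lambda>x. C * norm (H x))" using H by simp
    note [measurable] = that(1)
    show "(\<lambda>x. H x * complex_of_real (g x)) \<in> borel_measurable (mu \<alpha>)" by measurable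
    show "AE x in mu \<alpha>. norm (H x * complex_of_real (g x)) \<le> norm (C * norm (H x))"
      using mult_right_mono[OF order_trans[OF that(2) abs_ge_self], of "norm (H _)"]
      by (auto simp: norm_mult abs_mult mult.commute)
  qed
  have mono: "integrable (mu \<alpha>) (\<lambda>x. H x * complex_of_real (s x ^ n))"
    "(\<integral>x. H x * complex_of_real (s x ^ n) \<partial>mu \<alpha>) = 0" for n
    using int[of "real n + 1"] zero[of "real n + 1"] pw[of _ n] by auto
  have poly: "(\<integral>x. H x * complex_of_real (g (s x)) \<partial>mu \<alpha>) = 0" if pg: "real_polynomial_function g" for g
  proof -
    obtain a n where g: "g = (\<lambda>x. \<Sum>i\<le>n. a i * x ^ i)"
      using pg by (auto simp: real_polynomial_function_iff_sum)
    have "(\<integral>x. H x * complex_of_real (g (s x)) \<partial>mu \<alpha>)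
      = (\<integral>x. (\<Sum>i\<le>n. complex_of_real (a i) * (H x * complex_of_real (s x ^ i))) \<partial>mu \<alpha>)"
      unfolding g by (simp add: sum_distrib_left mult_ac)
    also have "\<dots> = (\<Sum>i\<le>n. complex_of_real (a i) * (\<integral>x. H x * complex_of_real (s x ^ i) \<partial>mu \<alpha>))"
      using mono(1) by (subst Bochner_Integration.integral_sum) auto
    finally show ?thesis using mono(2) by simp
  qed
  have cont: "(\<integral>x. H x * complex_of_real (g (s x)) \<partial>mu \<alpha>) = 0" if g: "continuous_on UNIV g" for g :: "real \<Rightarrow> real"
  proof -
    define N where "N = (\<integral>x. norm (H x) \<partial>mu \<alpha>)"
    have gb: "\<exists>C. \<forall>x. \<bar>g (s x)\<bar> \<le> C" if "continuous_on UNIV g" for g :: "real \<Rightarrow> real"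
    proof -
      have "compact (g ` {0..1})"
        using that by (intro compact_continuous_image) (auto intro: continuous_on_subset)
      then obtain C where "\<forall>y\<in>g ` {0..1}. norm y \<le> C" using compact_imp_bounded bounded_iff by blast
      then show ?thesis using s by (intro exI[of _ C]) (auto simp: less_imp_le)
    qed
    have gi: "integrable (mu \<alpha>) (\<lambda>x. H x * complex_of_real (g (s x)))" if "continuous_on UNIV g" for g :: "real \<Rightarrow> real"
      using gb[OF that] bounded_int[of "\<lambda>x. g (s x)"] measurable_compose[OF sm borel_measurable_continuous_onI[OF that]] by blast
    have "norm (\<integral>x. H x * complex_of_real (g (s x)) \<partial>mu \<alpha>) \<le> N * e" if "e > 0" for e
    proof -
      obtain q where q: "real_polynomial_function q" "\<And>x. x \<in> {0..1} \<Longrightarrow> \<bar>g x - q x\<bar> < e"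
        using Stone_Weierstrass_real_polynomial_function[of "{0..1}" g e] g \<open>e > 0\<close>
        by (metis compact_Icc continuous_on_subset subset_UNIV)
      have qc: "continuous_on UNIV q"
        using q(1) by (intro continuous_on_polymonial_function) (simp add: real_polynomial_function_eq)
      have "(\<integral>x. H x * complex_of_real (g (s x)) \<partial>mu \<alpha>)
        = (\<integral>x. H x * complex_of_real (g (s x)) - H x * complex_of_real (q (s x)) \<partial>mu \<alpha>)"
        using gi[OF g] gi[OF qc] poly[OF q(1)] by simp
      also have "norm \<dots> \<le> (\<integral>x. norm (H x) * e \<partial>mu \<alpha>)"
      proof (rule order_trans[OF integral_norm_bound integral_mono])
        show "integrable (mu \<alpha>) (\<lambda>x. norm (H x * complex_of_real (g (s x)) - H x * complex_of_real (q (s x))))"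
          using gi[OF g] gi[OF qc] by simp
        show "norm (H x * complex_of_real (g (s x)) - H x * complex_of_real (q (s x))) \<le> norm (H x) * e" for x
        proof -
          have "norm (H x * complex_of_real (g (s x)) - H x * complex_of_real (q (s x))) = norm (H x) * \<bar>g (s x) - q (s x)\<bar>"
            by (simp flip: right_diff_distrib of_real_diff add: norm_mult)
          also have "\<dots> \<le> norm (H x) * e"
            using q(2)[of "s x"] s[of x] by (intro mult_left_mono) auto
          finally show ?thesis .
        qed
      qed (use H in simp)
      finally show ?thesis using H by (simp add: N_def)
    qed
    moreover have N0: "N \<ge> 0" by (simp add: N_def integral_nonneg_AE)
    ultimately have "norm (\<integral>x. H x * complex_of_real (g (s x)) \<partial>mu \<alpha>) \<le> 0 + e" if "e > 0" for e
    proof -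
      \<comment> \<open>Dividing by \<open>N + 1\<close> covers the case
        \<open>N = 0\<close>.\<close>
      have "norm (\<integral>x. H x * complex_of_real (g (s x)) \<partial>mu \<alpha>) \<le> N * (e / (N + 1))"
        using \<open>\<And>e. e > 0 \<Longrightarrow> norm (\<integral>x. H x * complex_of_real (g (s x)) \<partial>mu \<alpha>) \<le> N * e\<close>[of "e / (N + 1)"] that N0 by simp
      also have "\<dots> \<le> e" using that N0 by (simp add: field_simps)
      finally show ?thesis by simp
    qed
    then have "norm (\<integral>x. H x * complex_of_real (g (s x)) \<partial>mu \<alpha>) \<le> 0" by (rule field_le_epsilon)
    then show ?thesis by simp
  qed
  have half: "(\<integral>x. indicator {..<b} x *\<^sub>R H x \<partial>mu \<alpha>) = 0" for b
  proof (cases "b > 0")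
    case True
    \<comment> \<open>Clipped ramps of slope \<open>k\<close> starting at \<open>s b\<close>: they
      tend to the indicator of values above \<open>s b\<close>, that is of positive \<open>x\<close>
      below \<open>b\<close>.\<close>
    define g where "g k y = min 1 (max 0 (real k * (y - s b)))" for k :: nat and y :: real
    have gc: "continuous_on UNIV (g k)" for k unfolding g_def by (intro continuous_intros)
    have "(\<lambda>k. \<integral>x. H x * complex_of_real (g k (s x)) \<partial>mu \<alpha>) \<longlonglongrightarrow> (\<integral>x. indicator {..<b} x *\<^sub>R H x \<partial>mu \<alpha>)"
    proof (rule integral_dominated_convergence)
      show "integrable (mu \<alpha>) (\<lambda>x. norm (H x))" using H by simp
      have [measurable]: "(indicator {..<b} :: real \<Rightarrow> real) \<in> borel_measurable (mu \<alpha>)"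
        by (rule measurable_muI) simp
      show "(\<lambda>x. indicator {..<b} x *\<^sub>R H x) \<in> borel_measurable (mu \<alpha>)" by measurable
      show "(\<lambda>x. H x * complex_of_real (g k (s x))) \<in> borel_measurable (mu \<alpha>)" for k
        unfolding g_def by measurable
      show "AE x in mu \<alpha>. norm (H x * complex_of_real (g k (s x))) \<le> norm (H x)" for k
        by (auto simp: norm_mult g_def intro!: mult_left_le)
      show "AE x in mu \<alpha>. (\<lambda>k. H x * complex_of_real (g k (s x))) \<longlonglongrightarrow> indicator {..<b} x *\<^sub>R H x"
      proof (rule AE_I2)
        fix x assume "x \<in> space (mu \<alpha>)"
        then have x: "x > 0" by simp
        have lt: "s b < s x \<longleftrightarrow> x < b"
          using x True power_strict_mono[of x b 2] power_mono[of b x 2]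
          by (cases "x < b") (auto simp: s_def not_less)
        have "(\<lambda>k. g k (s x)) \<longlonglongrightarrow> indicator {..<b} x"
        proof (cases "x < b")
          case True
          then have d: "s x - s b > 0" using lt by simp
          obtain K :: nat where K: "1 < real K * (s x - s b)"
            using reals_Archimedean3[OF d] by blast
          have "g k (s x) = 1" if "k \<ge> K" for k
          proof -
            have "real K * (s x - s b) \<le> real k * (s x - s b)" using that d by (intro mult_right_mono) auto
            then show ?thesis using K by (simp add: g_def)
          qed
          then have "eventually (\<lambda>k. g k (s x) = indicator {..<b} x) sequentially"
            using True by (auto simp: eventually_sequentially)
          then show ?thesis by (rule tendsto_eventually)
        next
          case False
          then have "s x - s b \<le> 0" using lt by simp
          then have "g k (s x) = 0" for k
            by (simp add: g_def mult_nonneg_nonpos)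
          then show ?thesis using False by simp
        qed
        then have "(\<lambda>k. H x * complex_of_real (g k (s x))) \<longlonglongrightarrow> H x * complex_of_real (indicator {..<b} x)"
          by (intro tendsto_intros)
        then show "(\<lambda>k. H x * complex_of_real (g k (s x))) \<longlonglongrightarrow> indicator {..<b} x *\<^sub>R H x"
          by (simp add: scaleR_conv_of_real mult.commute)
      qed
    qed
    then show ?thesis using cont[OF gc] by (simp add: LIMSEQ_const_iff)
  next
    case False
    have "(\<integral>x. indicator {..<b} x *\<^sub>R H x \<partial>mu \<alpha>) = (\<integral>x. 0 \<partial>mu \<alpha>)"
      using False by (intro Bochner_Integration.integral_cong) auto
    then show ?thesis by simp
  qed
  have total: "(\<integral>x. H x \<partial>mu \<alpha>) = 0" using mono(2)[of 0] by simp
  have "AE x in mu \<alpha>. H x = 0"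
  proof (rule mu.density_zero[OF H])
    fix A assume "A \<in> sets (mu \<alpha>)"
    then have A: "A \<in> sets borel" by (auto simp: sets_restrict_space)
    show "set_lebesgue_integral (mu \<alpha>) A H = 0"
      unfolding set_lebesgue_integral_def
      by (rule integral_indicator_eq_0_borel[OF _ H total half A]) (auto simp: sets_restrict_space)
  qed
  then show ?thesis by (auto simp: H_def s_def)
qed

section \<open>The multiplier on integrable functions\<close>

lemma Lp_1_iff: "u \<in> Lp 1 M \<longleftrightarrow> integrable M u"
  by (auto simp: Lp_def integrable_norm_iff)

lemma Lp_2_D:
  assumes "u \<in> Lp 2 M"
  shows "u \<in> borel_measurable M" "integrable M (\<lambda>x. (norm (u x))\<^sup>2)"
  using assms by (auto simp: Lp_def)

lemma Lp_2_mult_integrable: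
  assumes u: "u \<in> Lp 2 M" and \<psi>[measurable]: "\<psi> \<in> borel_measurable M" and \<psi>2: "integrable M (\<lambda>x. (\<psi> x)\<^sup>2)"
  shows "integrable M (\<lambda>x. u x * complex_of_real (\<psi> x))"
proof (rule Bochner_Integration.integrable_bound)
  note [measurable] = Lp_2_D(1)[OF u]
  show "integrable M (\<lambda>x. (norm (u x))\<^sup>2 + (\<psi> x)\<^sup>2)" using Lp_2_D[OF u] \<psi>2 by simp
  have *: "a * b \<le> a\<^sup>2 + b\<^sup>2" if "0 \<le> a" "0 \<le> b" for a b :: real
    using sum_squares_bound[of a b] mult_nonneg_nonneg[OF that] by simp
  show "AE x in M. norm (u x * complex_of_real (\<psi> x)) \<le> norm ((norm (u x))\<^sup>2 + (\<psi> x)\<^sup>2)"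
    using *[of "norm (u _)" "\<bar>\<psi> _\<bar>"] by (auto simp: norm_mult)
qed (use Lp_2_D(1)[OF u] in measurable)

lemma Lp_2_diff:
  assumes "u \<in> Lp 2 M" "v \<in> Lp 2 M"
  shows "(\<lambda>x. u x - v x) \<in> Lp 2 M"
proof -
  note [measurable] = Lp_2_D(1)[OF assms(1)] Lp_2_D(1)[OF assms(2)]
  have "integrable M (\<lambda>x. (norm (u x - v x))\<^sup>2)"
  proof (rule Bochner_Integration.integrable_bound)
    show "integrable M (\<lambda>x. 2 * (norm (u x))\<^sup>2 + 2 * (norm (v x))\<^sup>2)"
      using Lp_2_D(2)[OF assms(1)] Lp_2_D(2)[OF assms(2)] by simp
    have "(norm (a - b))\<^sup>2 \<le> 2 * (norm a)\<^sup>2 + 2 * (norm b)\<^sup>2" for a b :: complex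
    proof -
      have "(norm (a - b))\<^sup>2 \<le> (norm a + norm b)\<^sup>2"
        by (intro power_mono norm_triangle_ineq4) auto
      then show ?thesis using sum_squares_bound[of "norm a" "norm b"] by (simp add: power2_sum)
    qed
    then show "AE x in M. norm ((norm (u x - v x))\<^sup>2) \<le> norm (2 * (norm (u x))\<^sup>2 + 2 * (norm (v x))\<^sup>2)"
      by auto
  qed measurable
  then show ?thesis by (simp add: Lp_def)
qed

text \<open>Norm convergence implies weak convergence. Instead of the Cauchy-Schwarz inequality, the
  product is split by 2 a b \<le> a^2 / e + e b^2 with a weight \<open>e k\<close> adapted to the
  distance \<open>l k\<close>.\<close>

lemma Lp_2_pairing_tendsto:
  assumes conv: "Lp_converges 2 M u f" and \<psi>[measurable]: "\<psi> \<in> borel_measurable M" and \<psi>2: "integrable M (\<lambda>x. (\<psi> x)\<^sup>2)"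
  shows "(\<lambda>k. \<integral>x. u k x * complex_of_real (\<psi> x) \<partial>M) \<longlonglongrightarrow> (\<integral>x. f x * complex_of_real (\<psi> x) \<partial>M)"
proof -
  have u: "u k \<in> Lp 2 M" for k
    using conv by (auto simp: Lp_converges_def)
  have f: "f \<in> Lp 2 M" and L: "(\<lambda>k. Lp_norm 2 M (\<lambda>x. u k x - f x)) \<longlonglongrightarrow> 0"
    using conv by (auto simp: Lp_converges_def)
  define l where "l k = Lp_norm 2 M (\<lambda>x. u k x - f x)" for k
  define B where "B = (\<integral>x. (\<psi> x)\<^sup>2 \<partial>M)"
  \<comment> \<open>The weight has to be positive although \<open>l k\<close> may be 0, at least
    \<open>l k\<close> so that l^2 / e \<le> l, and a null sequence.\<close>
  define e where "e k = l k + 1 / (real k + 1)" for k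
  have d: "(\<lambda>x. u k x - f x) \<in> Lp 2 M" for k using u f by (rule Lp_2_diff)
  have l0: "l k \<ge> 0" for k by (simp add: l_def Lp_norm_def)
  then have e0: "e k > 0" for k by (simp add: e_def add_nonneg_pos)
  have l2: "(\<integral>x. (norm (u k x - f x))\<^sup>2 \<partial>M) = (l k)\<^sup>2" for k
  proof -
    have "(\<integral>x. (norm (u k x - f x))\<^sup>2 \<partial>M) \<ge> 0" by (simp add: integral_nonneg_AE)
    then show ?thesis by (simp add: l_def Lp_norm_def powr_half_sqrt)
  qed
  have I: "norm ((\<integral>x. u k x * complex_of_real (\<psi> x) \<partial>M) - (\<integral>x. f x * complex_of_real (\<psi> x) \<partial>M))
      \<le> l k / 2 + e k / 2 * B" for k
  proof -
    have "(\<integral>x. u k x * complex_of_real (\<psi> x) \<partial>M) - (\<integral>x. f x * complex_of_real (\<psi> x) \<partial>M)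
       = (\<integral>x. (u k x - f x) * complex_of_real (\<psi> x) \<partial>M)"
      using Lp_2_mult_integrable[OF u \<psi> \<psi>2] Lp_2_mult_integrable[OF f \<psi> \<psi>2]
      by (simp add: left_diff_distrib)
    also have "norm \<dots> \<le> (\<integral>x. norm ((u k x - f x) * complex_of_real (\<psi> x)) \<partial>M)"
      by (rule integral_norm_bound)
    also have "\<dots> \<le> (\<integral>x. 1 / (2 * e k) * (norm (u k x - f x))\<^sup>2 + e k / 2 * (\<psi> x)\<^sup>2 \<partial>M)"
    proof (rule integral_mono)
      show "integrable M (\<lambda>x. norm ((u k x - f x) * complex_of_real (\<psi> x)))"
        using Lp_2_mult_integrable[OF d \<psi> \<psi>2] by (rule integrable_norm)
      show "integrable M (\<lambda>x. 1 / (2 * e k) * (norm (u k x - f x))\<^sup>2 + e k / 2 * (\<psi> x)\<^sup>2)"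
        using Lp_2_D(2)[OF d] \<psi>2 by simp
      fix x
      have "2 * norm (u k x - f x) * (e k * \<bar>\<psi> x\<bar>) \<le> (norm (u k x - f x))\<^sup>2 + (e k * \<bar>\<psi> x\<bar>)\<^sup>2"
        by (rule sum_squares_bound)
      then show "norm ((u k x - f x) * complex_of_real (\<psi> x)) \<le> 1 / (2 * e k) * (norm (u k x - f x))\<^sup>2 + e k / 2 * (\<psi> x)\<^sup>2"
        using e0[of k] unfolding norm_mult norm_of_real by (simp add: field_simps power2_eq_square)
    qed
    also have "\<dots> = (l k)\<^sup>2 / (2 * e k) + e k / 2 * B"
      using Lp_2_D(2)[OF d] \<psi>2 by (simp add: l2 B_def)
    also have "(l k)\<^sup>2 / (2 * e k) \<le> l k / 2"
    proof -
      have "l k * l k \<le> l k * e k" using l0[of k] by (intro mult_left_mono) (auto simp: e_def)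
      then show ?thesis using e0[of k] by (simp add: field_simps power2_eq_square)
    qed
    finally show ?thesis by simp
  qed
  have "(\<lambda>k. 1 / (real k + 1)) \<longlonglongrightarrow> 0"
    using LIMSEQ_inverse_real_of_nat by (simp add: inverse_eq_divide add.commute)
  then have "(\<lambda>k. l k / 2 + e k / 2 * B) \<longlonglongrightarrow> 0 / 2 + (0 + 0) / 2 * B"
    unfolding e_def using L[folded l_def] by (intro tendsto_intros) auto
  then have "(\<lambda>k. (\<integral>x. u k x * complex_of_real (\<psi> x) \<partial>M) - (\<integral>x. f x * complex_of_real (\<psi> x) \<partial>M)) \<longlonglongrightarrow> 0"
    by (intro Lim_null_comparison[OF always_eventually[OF allI[OF I]]]) simp
  then show ?thesis by (simp add: LIM_zero_iff)
qed

section \<open>Identification of Hankel images by Gaussian pairings\<close>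

definition gauss :: "real \<Rightarrow> real \<Rightarrow> real" where
  "gauss t x = exp (- (t * x\<^sup>2 / 2))"

lemma measurable_gauss: "gauss t \<in> borel_measurable (mu \<alpha>)"
  unfolding gauss_def[abs_def] by (rule measurable_muI) simp

lemma gauss_integrable:
  assumes "\<alpha> \<ge> -1/2" "t > 0"
  shows "integrable (mu \<alpha>) (gauss t)" "integrable (mu \<alpha>) (\<lambda>x. (gauss t x)\<^sup>2)"
proof -
  show "integrable (mu \<alpha>) (gauss t)"
    using integrable_gauss[OF assms] by (simp add: gauss_def[abs_def])
  have "(gauss t x)\<^sup>2 = gauss (2 * t) x" for x
    by (simp add: gauss_def flip: exp_double)
  then show "integrable (mu \<alpha>) (\<lambda>x. (gauss t x)\<^sup>2)"
    using integrable_gauss[of \<alpha> "2 * t"] assms by (simp add: gauss_def[abs_def])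
qed

lemma hankel_gauss':
  assumes "\<alpha> \<ge> -1/2" "t > 0" "x > 0"
  shows "hankel \<alpha> (\<lambda>y. complex_of_real (gauss t y)) x = complex_of_real (t powr (- \<alpha> - 1)) * complex_of_real (gauss (1 / t) x)"
  using hankel_gauss[OF assms] by (simp add: gauss_def)

lemma hankel_gauss_pairing:
  assumes \<alpha>: "\<alpha> \<ge> -1/2" and t: "t > 0" and u: "integrable (mu \<alpha>) u"
  shows "(\<integral>x. hankel \<alpha> u x * complex_of_real (gauss t x) \<partial>mu \<alpha>)
    = complex_of_real (t powr (- \<alpha> - 1)) * (\<integral>x. u x * complex_of_real (gauss (1 / t) x) \<partial>mu \<alpha>)"
proof -
  have "(\<integral>x. hankel \<alpha> u x * complex_of_real (gauss t x) \<partial>mu \<alpha>)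
      = (\<integral>y. u y * hankel \<alpha> (\<lambda>y. complex_of_real (gauss t y)) y \<partial>mu \<alpha>)"
    using gauss_integrable(1)[OF \<alpha> t] by (intro hankel_symmetric[OF \<alpha> u]) simp
  also have "\<dots> = (\<integral>y. complex_of_real (t powr (- \<alpha> - 1)) * (u y * complex_of_real (gauss (1 / t) y)) \<partial>mu \<alpha>)"
    by (rule Bochner_Integration.integral_cong) (auto simp: hankel_gauss'[OF \<alpha> t])
  finally show ?thesis by simp
qed

text \<open>The identity for integrable functions survives the two L^2 limits in the definition of
  \<open>hankel_L2\<close>. It is the only analytic property of the extended transform that is used
  besides membership in L^2.\<close>

lemma hankel_L2_gauss_pairing:
  assumes \<alpha>: "\<alpha> \<ge> -1/2" and t: "t > 0" and F: "hankel_L2 \<alpha> f F"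
  shows "(\<integral>x. F x * complex_of_real (gauss t x) \<partial>mu \<alpha>)
    = complex_of_real (t powr (- \<alpha> - 1)) * (\<integral>x. f x * complex_of_real (gauss (1 / t) x) \<partial>mu \<alpha>)"
proof -
  obtain u where u: "\<And>k. u k \<in> Lp 1 (mu \<alpha>)" and uf: "Lp_converges 2 (mu \<alpha>) u f"
    and uF: "Lp_converges 2 (mu \<alpha>) (\<lambda>k. hankel \<alpha> (u k)) F"
    using F unfolding hankel_L2_def by blast
  have t': "1 / t > 0" using t by simp
  have "(\<lambda>k. \<integral>x. hankel \<alpha> (u k) x * complex_of_real (gauss t x) \<partial>mu \<alpha>) \<longlonglongrightarrow> (\<integral>x. F x * complex_of_real (gauss t x) \<partial>mu \<alpha>)"
    by (rule Lp_2_pairing_tendsto[OF uF measurable_gauss gauss_integrable(2)[OF \<alpha> t]])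
  moreover have "(\<lambda>k. complex_of_real (t powr (- \<alpha> - 1)) * (\<integral>x. u k x * complex_of_real (gauss (1 / t) x) \<partial>mu \<alpha>))
      \<longlonglongrightarrow> complex_of_real (t powr (- \<alpha> - 1)) * (\<integral>x. f x * complex_of_real (gauss (1 / t) x) \<partial>mu \<alpha>)"
    by (intro tendsto_mult_left Lp_2_pairing_tendsto[OF uf measurable_gauss gauss_integrable(2)[OF \<alpha> t']])
  moreover have "(\<integral>x. hankel \<alpha> (u k) x * complex_of_real (gauss t x) \<partial>mu \<alpha>)
      = complex_of_real (t powr (- \<alpha> - 1)) * (\<integral>x. u k x * complex_of_real (gauss (1 / t) x) \<partial>mu \<alpha>)" for k
    using u by (intro hankel_gauss_pairing \<alpha> t) (simp add: Lp_1_iff)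
  ultimately show ?thesis using LIMSEQ_unique by auto
qed

text \<open>The function \<open>g\<close> is square integrable while the transform of
  \<open>u\<close> is bounded; their difference is integrable against every Gaussian, which is all
  that \<open>gauss_transform_unique\<close> asks for.\<close>

lemma eq_hankel_AE_I:
  assumes \<alpha>: "\<alpha> \<ge> -1/2" and u: "integrable (mu \<alpha>) u" and g: "g \<in> Lp 2 (mu \<alpha>)"
    and pairing: "\<And>t. t > 0 \<Longrightarrow> (\<integral>x. g x * complex_of_real (gauss t x) \<partial>mu \<alpha>)
      = complex_of_real (t powr (- \<alpha> - 1)) * (\<integral>x. u x * complex_of_real (gauss (1 / t) x) \<partial>mu \<alpha>)"
  shows "AE x in mu \<alpha>. g x = hankel \<alpha> u x"
proof -
  have i1: "integrable (mu \<alpha>) (\<lambda>x. g x * complex_of_real (gauss t x))" if "t > 0" for t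
    using Lp_2_mult_integrable[OF g measurable_gauss gauss_integrable(2)[OF \<alpha> that]] .
  have i2: "integrable (mu \<alpha>) (\<lambda>x. hankel \<alpha> u x * complex_of_real (gauss t x))" if "t > 0" for t
    using integrable_hankel_mult[OF \<alpha> u] gauss_integrable(1)[OF \<alpha> that] by simp
  have "AE x in mu \<alpha>. g x - hankel \<alpha> u x = 0"
  proof (rule gauss_transform_unique, unfold gauss_def[symmetric])
    fix t :: real assume t: "t > 0"
    show "integrable (mu \<alpha>) (\<lambda>x. (g x - hankel \<alpha> u x) * complex_of_real (gauss t x))"
      using i1[OF t] i2[OF t] by (simp add: left_diff_distrib)
    show "(\<integral>x. (g x - hankel \<alpha> u x) * complex_of_real (gauss t x) \<partial>mu \<alpha>) = 0"
      using i1[OF t] i2[OF t] pairing[OF t] hankel_gauss_pairing[OF \<alpha> t u] by (simp add: left_diff_distrib)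
  qed
  then show ?thesis by simp
qed

lemma hankel_L2_eq_hankel:
  assumes "\<alpha> \<ge> -1/2" "integrable (mu \<alpha>) f" "hankel_L2 \<alpha> f F"
  shows "AE x in mu \<alpha>. F x = hankel \<alpha> f x"
proof (rule eq_hankel_AE_I[OF assms(1,2)])
  show "F \<in> Lp 2 (mu \<alpha>)" using assms(3) by (auto simp: hankel_L2_def Lp_converges_def)
qed (rule hankel_L2_gauss_pairing[OF assms(1) _ assms(3)])

definition band :: "real \<Rightarrow> (real \<Rightarrow> complex) \<Rightarrow> real \<Rightarrow> complex" where
  "band \<alpha> f t = complex_of_real (indicator {0..1} t) * hankel \<alpha> f t"

lemma integrable_band:
  assumes "\<alpha> \<ge> -1/2" "integrable (mu \<alpha>) f"
  shows "integrable (mu \<alpha>) (band \<alpha> f)"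
  using integrable_hankel_mult[OF assms, of "\<lambda>t. complex_of_real (indicator {0..1} t)"] integrable_mu_Icc[OF assms(1), of 1]
  by (simp add: band_def[abs_def] mult.commute)

text \<open>The Hankel image of \<open>g\<close> is known to be the band-limited function, so
  \<open>g\<close> has to be recovered from its image. On Gaussians the transform is visibly an
  involution, and running the pairing identity backwards with \<open>1 / t\<close> replaces an
  inversion theorem.\<close>

lemma multiplier_L2_eq_hankel:
  assumes \<alpha>: "\<alpha> \<ge> -1/2" and f: "integrable (mu \<alpha>) f" and g: "multiplier_L2 \<alpha> f g"
  shows "AE x in mu \<alpha>. g x = hankel \<alpha> (band \<alpha> f) x"
proof -
  obtain F G where F: "hankel_L2 \<alpha> f F" and G: "hankel_L2 \<alpha> g G"
    and GF: "AE x in mu \<alpha>. G x = indicator {0..1} x * F x"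
    using g unfolding multiplier_L2_def by blast
  have GB: "AE x in mu \<alpha>. G x = band \<alpha> f x"
    using GF hankel_L2_eq_hankel[OF \<alpha> f F] by eventually_elim (auto simp: band_def indicator_def)
  have "G \<in> Lp 2 (mu \<alpha>)" using G by (auto simp: hankel_L2_def Lp_converges_def)
  then have [measurable]: "G \<in> borel_measurable (mu \<alpha>)" by (rule Lp_2_D)
  note [measurable] = borel_measurable_integrable[OF integrable_band[OF \<alpha> f]] measurable_gauss
  show ?thesis
  proof (rule eq_hankel_AE_I[OF \<alpha> integrable_band[OF \<alpha> f]])
    show "g \<in> Lp 2 (mu \<alpha>)" using G by (auto simp: hankel_L2_def Lp_converges_def)
    fix t :: real assume t: "t > 0"
    have "(\<integral>x. band \<alpha> f x * complex_of_real (gauss (1 / t) x) \<partial>mu \<alpha>) = (\<integral>x. G x * complex_of_real (gauss (1 / t) x) \<partial>mu \<alpha>)"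
      by (rule integral_cong_AE) (use GB in \<open>auto elim: eventually_mono\<close>)
    also have "\<dots> = complex_of_real ((1 / t) powr (- \<alpha> - 1)) * (\<integral>x. g x * complex_of_real (gauss t x) \<partial>mu \<alpha>)"
      using hankel_L2_gauss_pairing[OF \<alpha> _ G, of "1 / t"] t by simp
    finally have "complex_of_real (t powr (- \<alpha> - 1)) * (\<integral>x. band \<alpha> f x * complex_of_real (gauss (1 / t) x) \<partial>mu \<alpha>)
      = complex_of_real (t powr (- \<alpha> - 1) * (1 / t) powr (- \<alpha> - 1)) * (\<integral>x. g x * complex_of_real (gauss t x) \<partial>mu \<alpha>)"
      by simp
    \<comment> \<open>The factors for \<open>t\<close> and \<open>1 / t\<close> are reciprocal: this
      is the involution.\<close>
    also have "t powr (- \<alpha> - 1) * (1 / t) powr (- \<alpha> - 1) = 1"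
      using t by (simp flip: powr_mult)
    finally show "(\<integral>x. g x * complex_of_real (gauss t x) \<partial>mu \<alpha>)
      = complex_of_real (t powr (- \<alpha> - 1)) * (\<integral>x. band \<alpha> f x * complex_of_real (gauss (1 / t) x) \<partial>mu \<alpha>)"
      by simp
  qed
qed

section \<open>The series and the multiplier\<close>

text \<open>The reproducing kernel of the functions whose Hankel transform is supported in
  [0,1].\<close>

definition kernel :: "real \<Rightarrow> real \<Rightarrow> real \<Rightarrow> real" where
  "kernel \<alpha> x y = (\<integral>t. indicator {0..1} t * ker \<alpha> x t * ker \<alpha> y t \<partial>mu \<alpha>)"

lemma measurable_j: "\<alpha> \<ge> -1/2 \<Longrightarrow> j \<alpha> n \<in> borel_measurable (mu \<alpha>)"
  by (intro continuous_mu_measurable continuous_on_j)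

text \<open>From here on \<open>f\<close> enters only through the finiteness of its integral against
  \<open>profile\<close>, which both L^p functions in the given range and the kernel estimates can
  use.\<close>

lemma integrable_mult_j:
  assumes \<alpha>: "\<alpha> \<ge> -1/2" and f: "f \<in> borel_measurable (mu \<alpha>)"
    and fp: "integrable (mu \<alpha>) (\<lambda>y. norm (f y) * profile \<alpha> y)"
  shows "integrable (mu \<alpha>) (\<lambda>y. f y * complex_of_real (j \<alpha> n y))"
    and "(\<integral>y. norm (f y * complex_of_real (j \<alpha> n y)) \<partial>mu \<alpha>) \<le> jbd \<alpha> n * (\<integral>y. norm (f y) * profile \<alpha> y \<partial>mu \<alpha>)"
proof -
  note [measurable] = f measurable_j[OF \<alpha>]
  have le: "norm (f y * complex_of_real (j \<alpha> n y)) \<le> jbd \<alpha> n * (norm (f y) * profile \<alpha> y)" if "y > 0" for y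
  proof -
    have "norm (f y) * \<bar>j \<alpha> n y\<bar> \<le> norm (f y) * (jbd \<alpha> n * profile \<alpha> y)"
      using j_profile[OF \<alpha> that] by (intro mult_left_mono) auto
    then show ?thesis by (simp add: norm_mult mult_ac)
  qed
  show i: "integrable (mu \<alpha>) (\<lambda>y. f y * complex_of_real (j \<alpha> n y))"
  proof (rule Bochner_Integration.integrable_bound)
    show "integrable (mu \<alpha>) (\<lambda>y. jbd \<alpha> n * (norm (f y) * profile \<alpha> y))" using fp by simp
    show "AE y in mu \<alpha>. norm (f y * complex_of_real (j \<alpha> n y)) \<le> norm (jbd \<alpha> n * (norm (f y) * profile \<alpha> y))"
      unfolding real_norm_def by (intro AE_I2 order_trans[OF le abs_ge_self]) simp
    show "(\<lambda>y. f y * complex_of_real (j \<alpha> n y)) \<in> borel_measurable (mu \<alpha>)" by measurable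
  qed
  have "(\<integral>y. norm (f y * complex_of_real (j \<alpha> n y)) \<partial>mu \<alpha>) \<le> (\<integral>y. jbd \<alpha> n * (norm (f y) * profile \<alpha> y) \<partial>mu \<alpha>)"
    using fp by (intro integral_mono_AE integrable_norm[OF i] AE_I2 le) auto
  then show "(\<integral>y. norm (f y * complex_of_real (j \<alpha> n y)) \<partial>mu \<alpha>) \<le> jbd \<alpha> n * (\<integral>y. norm (f y) * profile \<alpha> y \<partial>mu \<alpha>)"
    by simp
qed

lemma summable_coef:
  assumes \<alpha>: "\<alpha> \<ge> -1/2" and f: "f \<in> borel_measurable (mu \<alpha>)"
    and fp: "integrable (mu \<alpha>) (\<lambda>y. norm (f y) * profile \<alpha> y)" and x: "x > 0"
  shows "summable (\<lambda>n. norm (coef \<alpha> f n * complex_of_real (j \<alpha> n x)))"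
proof (rule summable_comparison_test'[where N = 0])
  let ?I = "\<integral>y. norm (f y) * profile \<alpha> y \<partial>mu \<alpha>"
  show "summable (\<lambda>n. ?I * (jbd \<alpha> n * \<bar>j \<alpha> n x\<bar>))"
    by (intro summable_mult summable_jbd_j \<alpha> x)
  fix n :: nat
  have "norm (coef \<alpha> f n) \<le> jbd \<alpha> n * ?I"
    unfolding coef_def using integral_norm_bound integrable_mult_j(2)[OF \<alpha> f fp] by (rule order_trans)
  then have "norm (coef \<alpha> f n) * \<bar>j \<alpha> n x\<bar> \<le> jbd \<alpha> n * ?I * \<bar>j \<alpha> n x\<bar>"
    by (rule mult_right_mono) simp
  then show "norm (norm (coef \<alpha> f n * complex_of_real (j \<alpha> n x))) \<le> ?I * (jbd \<alpha> n * \<bar>j \<alpha> n x\<bar>)"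
    by (simp add: norm_mult mult_ac)
qed

text \<open>Sum and integral may be exchanged because the bound on \<open>j\<close> separates: the
  integral of the norms is at most a constant depending on \<open>f\<close> times
  \<open>jbd \<alpha> n * \<bar>j \<alpha> n x\<bar>\<close>.\<close>

lemma coef_series_sums:
  assumes \<alpha>: "\<alpha> \<ge> -1/2" and f: "f \<in> borel_measurable (mu \<alpha>)"
    and fp: "integrable (mu \<alpha>) (\<lambda>y. norm (f y) * profile \<alpha> y)" and x: "x > 0"
  shows "(\<lambda>n. coef \<alpha> f n * complex_of_real (j \<alpha> n x)) sums (\<integral>y. f y * complex_of_real (kernel \<alpha> x y) \<partial>mu \<alpha>)"
proof -
  let ?g = "\<lambda>n y. f y * complex_of_real (j \<alpha> n y) * complex_of_real (j \<alpha> n x)"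
  have ss: "summable (\<lambda>n. \<bar>j \<alpha> n y\<bar> * \<bar>j \<alpha> n x\<bar>)" if "y > 0" for y
  proof (rule summable_comparison_test'[where N = 0])
    show "summable (\<lambda>n. profile \<alpha> y * (jbd \<alpha> n * \<bar>j \<alpha> n x\<bar>))"
      by (intro summable_mult summable_jbd_j \<alpha> x)
    fix n :: nat
    have "\<bar>j \<alpha> n y\<bar> * \<bar>j \<alpha> n x\<bar> \<le> jbd \<alpha> n * profile \<alpha> y * \<bar>j \<alpha> n x\<bar>"
      using j_profile[OF \<alpha> that] by (rule mult_right_mono) simp
    then show "norm (\<bar>j \<alpha> n y\<bar> * \<bar>j \<alpha> n x\<bar>) \<le> profile \<alpha> y * (jbd \<alpha> n * \<bar>j \<alpha> n x\<bar>)"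
      by (simp add: mult_ac)
  qed
  have "(\<lambda>n. \<integral>y. ?g n y \<partial>mu \<alpha>) sums (\<integral>y. (\<Sum>n. ?g n y) \<partial>mu \<alpha>)"
  proof (rule sums_integral)
    show "integrable (mu \<alpha>) (?g n)" for n
      using integrable_mult_j(1)[OF \<alpha> f fp] by simp
    show "AE y in mu \<alpha>. summable (\<lambda>n. norm (?g n y))"
      using ss by (auto simp: norm_mult mult.assoc intro: summable_mult)
    have "summable (\<lambda>n. (\<integral>y. norm (f y) * profile \<alpha> y \<partial>mu \<alpha>) * (jbd \<alpha> n * \<bar>j \<alpha> n x\<bar>))"
      by (intro summable_mult summable_jbd_j \<alpha> x)
    then show "summable (\<lambda>n. \<integral>y. norm (?g n y) \<partial>mu \<alpha>)"
    proof (rule summable_comparison_test'[where N = 0])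
      fix n :: nat
      have "(\<integral>y. norm (?g n y) \<partial>mu \<alpha>) = (\<integral>y. norm (f y * complex_of_real (j \<alpha> n y)) \<partial>mu \<alpha>) * \<bar>j \<alpha> n x\<bar>"
        unfolding norm_mult[of _ "complex_of_real (j \<alpha> n x)"] norm_of_real by (rule integral_mult_left_zero)
      also have "\<dots> \<le> jbd \<alpha> n * (\<integral>y. norm (f y) * profile \<alpha> y \<partial>mu \<alpha>) * \<bar>j \<alpha> n x\<bar>"
        using integrable_mult_j(2)[OF \<alpha> f fp] by (rule mult_right_mono) simp
      finally show "norm (\<integral>y. norm (?g n y) \<partial>mu \<alpha>) \<le> (\<integral>y. norm (f y) * profile \<alpha> y \<partial>mu \<alpha>) * (jbd \<alpha> n * \<bar>j \<alpha> n x\<bar>)"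
        by (simp add: integral_nonneg_AE mult_ac)
    qed
  qed
  also have "(\<integral>y. (\<Sum>n. ?g n y) \<partial>mu \<alpha>) = (\<integral>y. f y * complex_of_real (kernel \<alpha> x y) \<partial>mu \<alpha>)"
  proof (rule Bochner_Integration.integral_cong)
    fix y assume "y \<in> space (mu \<alpha>)"
    then have y: "y > 0" by simp
    have "(\<lambda>n. f y * complex_of_real (j \<alpha> n x * j \<alpha> n y)) sums (f y * complex_of_real (kernel \<alpha> x y))"
      unfolding kernel_def by (intro sums_mult sums_of_real j_kernel_sums \<alpha> x y)
    then show "(\<Sum>n. ?g n y) = f y * complex_of_real (kernel \<alpha> x y)"
      by (simp add: sums_iff mult_ac)
  qed simp
  finally show ?thesis by (simp add: coef_def)
qed

text \<open>The estimate comes from the series, not from the defining integral: bounding the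
  integrand shows boundedness in \<open>y\<close> but not the decay that makes the kernel integrable
  against \<open>f\<close>.\<close>

lemma kernel_bound:
  assumes \<alpha>: "\<alpha> \<ge> -1/2" and x: "x > 0" and y: "y > 0"
  shows "\<bar>kernel \<alpha> x y\<bar> \<le> (\<Sum>n. jbd \<alpha> n * \<bar>j \<alpha> n x\<bar>) * profile \<alpha> y"
proof -
  have S: "(\<lambda>n. j \<alpha> n x * j \<alpha> n y) sums kernel \<alpha> x y"
    unfolding kernel_def by (rule j_kernel_sums[OF \<alpha> x y])
  have le: "norm (j \<alpha> n x * j \<alpha> n y) \<le> jbd \<alpha> n * \<bar>j \<alpha> n x\<bar> * profile \<alpha> y" for n
    using mult_left_mono[OF j_profile[OF \<alpha> y], of "\<bar>j \<alpha> n x\<bar>" n] by (simp add: abs_mult mult_ac)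
  have s: "summable (\<lambda>n. jbd \<alpha> n * \<bar>j \<alpha> n x\<bar> * profile \<alpha> y)"
    by (intro summable_mult2 summable_jbd_j \<alpha> x)
  have "\<bar>kernel \<alpha> x y\<bar> = norm (\<Sum>n. j \<alpha> n x * j \<alpha> n y)" using S by (simp add: sums_iff)
  also have "\<dots> \<le> (\<Sum>n. jbd \<alpha> n * \<bar>j \<alpha> n x\<bar> * profile \<alpha> y)"
    by (rule norm_suminf_le[OF le s])
  also have "\<dots> = (\<Sum>n. jbd \<alpha> n * \<bar>j \<alpha> n x\<bar>) * profile \<alpha> y"
    by (rule suminf_mult2[symmetric, OF summable_jbd_j[OF \<alpha> x]])
  finally show ?thesis .
qed

text \<open>As a function of \<open>y\<close> the kernel is the Hankel transform of
  \<open>ker \<alpha> x\<close> cut off to [0,1]; \<open>hankel_symmetric\<close> moves the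
  transform over to \<open>f\<close>.\<close>

lemma kernel_integral_eq_hankel:
  assumes \<alpha>: "\<alpha> \<ge> -1/2" and f: "integrable (mu \<alpha>) f" and x: "x > 0"
  shows "(\<integral>y. f y * complex_of_real (kernel \<alpha> x y) \<partial>mu \<alpha>) = hankel \<alpha> (band \<alpha> f) x"
proof -
  define v where "v t = complex_of_real (ker \<alpha> x t) * complex_of_real (indicator {0..1} t)" for t
  have v: "integrable (mu \<alpha>) v"
    unfolding v_def using integrable_mu_Icc[OF \<alpha>, of 1] by (intro integrable_ker_mult[OF \<alpha>]) simp
  have "(\<integral>y. f y * complex_of_real (kernel \<alpha> x y) \<partial>mu \<alpha>) = (\<integral>y. f y * hankel \<alpha> v y \<partial>mu \<alpha>)"
  proof (rule Bochner_Integration.integral_cong)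
    fix y assume "y \<in> space (mu \<alpha>)"
    then have y: "y > 0" by simp
    have "complex_of_real (kernel \<alpha> x y) = hankel \<alpha> v y"
      unfolding hankel_ker[OF \<alpha> y] kernel_def v_def
      by (simp add: mult_ac flip: integral_complex_of_real)
    then show "f y * complex_of_real (kernel \<alpha> x y) = f y * hankel \<alpha> v y" by simp
  qed simp
  also have "\<dots> = (\<integral>t. hankel \<alpha> f t * v t \<partial>mu \<alpha>)"
    by (rule hankel_symmetric[OF \<alpha> f v, symmetric])
  also have "\<dots> = hankel \<alpha> (band \<alpha> f) x"
    unfolding hankel_ker[OF \<alpha> x] by (simp add: v_def band_def mult_ac)
  finally show ?thesis .
qed

section \<open>From integrable functions to L^p\<close>

lemma p0_ge_1: "\<alpha> \<ge> -1/2 \<Longrightarrow> p0 \<alpha> \<ge> 1"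
  by (simp add: p0_def field_simps)

text \<open>Hoelder's inequality in the additive form of Young. With the conjugate exponent
  \<open>q\<close>, the bound \<open>p < p1 \<alpha>\<close> rearranges to the integrability
  condition for \<open>profile powr q\<close>; for \<open>\<alpha> = -1/2\<close> it reads 0 <
  2.\<close>

lemma Lp_profile_integrable:
  assumes \<alpha>: "\<alpha> \<ge> -1/2" and p: "p0 \<alpha> < p" "ereal p < p1 \<alpha>" and f: "f \<in> Lp p (mu \<alpha>)"
  shows "integrable (mu \<alpha>) (\<lambda>y. norm (f y) * profile \<alpha> y)"
proof -
  have p1: "p > 1" using p0_ge_1[OF \<alpha>] p by simp
  define q where "q = p / (p - 1)"
  have q: "q > 1" "1 / p + 1 / q = 1" using p1 by (auto simp: q_def field_simps)
  have "p * (2 * \<alpha> + 1) < 4 * (\<alpha> + 1)"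
  proof (cases "\<alpha> = -1/2")
    case False
    then show ?thesis using p(2) \<alpha> by (simp add: p1_def pos_less_divide_eq)
  qed simp
  then have "(2 * \<alpha> + 2) * (p - 1) < (\<alpha> + 3/2) * p" by (simp add: algebra_simps)
  then have "(\<alpha> + 3/2) * q > 2 * \<alpha> + 2"
    using p1 by (simp add: q_def pos_less_divide_eq)
  then have i: "integrable (mu \<alpha>) (\<lambda>y. profile \<alpha> y powr q)"
    by (rule integrable_profile_powr[OF \<alpha>])
  have fm: "f \<in> borel_measurable (mu \<alpha>)" and fi: "integrable (mu \<alpha>) (\<lambda>y. norm (f y) powr p)"
    using f by (auto simp: Lp_def)
  note [measurable] = fm measurable_muI[OF measurable_profile]
  show ?thesis
  proof (rule Bochner_Integration.integrable_bound)
    show "integrable (mu \<alpha>) (\<lambda>y. norm (f y) powr p / p + profile \<alpha> y powr q / q)"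
      using i fi by simp
    show "(\<lambda>y. norm (f y) * profile \<alpha> y) \<in> borel_measurable (mu \<alpha>)" by measurable
    show "AE y in mu \<alpha>. norm (norm (f y) * profile \<alpha> y) \<le> norm (norm (f y) powr p / p + profile \<alpha> y powr q / q)"
    proof (rule AE_I2)
      fix y
      have "norm (f y) * profile \<alpha> y \<le> norm (f y) powr p / p + profile \<alpha> y powr q / q"
        by (rule Youngs_inequality) (use p1 q in auto)
      then show "norm (norm (f y) * profile \<alpha> y) \<le> norm (norm (f y) powr p / p + profile \<alpha> y powr q / q)"
        by simp
    qed
  qed
qed

lemma Lp_mono:
  assumes f: "f \<in> Lp p M" and g[measurable]: "g \<in> borel_measurable M" and le: "\<And>x. norm (g x) \<le> norm (f x)" and p: "p \<ge> 0"
  shows "g \<in> Lp p M"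
proof -
  have "integrable M (\<lambda>x. norm (g x) powr p)"
  proof (rule Bochner_Integration.integrable_bound)
    show "integrable M (\<lambda>x. norm (f x) powr p)" using f by (simp add: Lp_def)
    show "AE x in M. norm (norm (g x) powr p) \<le> norm (norm (f x) powr p)"
      using le p by (auto intro!: AE_I2 powr_mono2)
  qed measurable
  then show ?thesis by (simp add: Lp_def)
qed

text \<open>Cutting off both argument and value puts the function into L^1, L^2 and L^p at once, as
  \<open>mu\<close> is finite on bounded intervals.\<close>

definition truncate :: "(real \<Rightarrow> complex) \<Rightarrow> nat \<Rightarrow> real \<Rightarrow> complex" where
  "truncate f k x = (if x \<le> real k \<and> norm (f x) \<le> real k then f x else 0)"

lemma truncate_norm_le: "norm (truncate f k x) \<le> norm (f x)" "norm (truncate f k x - f x) \<le> norm (f x)"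
  by (auto simp: truncate_def)

lemma truncate_tendsto: "(\<lambda>k. truncate f k x) \<longlonglongrightarrow> f x"
proof (rule tendsto_eventually)
  obtain K :: nat where K: "max x (norm (f x)) \<le> real K" using real_arch_simple by blast
  have "truncate f k x = f x" if "k \<ge> K" for k
  proof -
    have "real K \<le> real k" using that by simp
    then show ?thesis using K by (simp add: truncate_def)
  qed
  then show "\<forall>\<^sub>F k in sequentially. truncate f k x = f x"
    by (auto simp: eventually_sequentially)
qed

lemma truncate_measurable:
  assumes [measurable]: "f \<in> borel_measurable (mu \<alpha>)"
  shows "truncate f k \<in> borel_measurable (mu \<alpha>)"
proof -
  note [measurable] = measurable_id_mu
  show ?thesis unfolding truncate_def[abs_def] by measurable
qed

lemma truncate_powr_integrable:
  assumes \<alpha>: "\<alpha> \<ge> -1/2" and f: "f \<in> borel_measurable (mu \<alpha>)" and q: "q > 0"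
  shows "integrable (mu \<alpha>) (\<lambda>x. norm (truncate f k x) powr q)"
proof (rule Bochner_Integration.integrable_bound)
  note [measurable] = truncate_measurable[OF f]
  show "integrable (mu \<alpha>) (\<lambda>x. real k powr q * indicator {0..real k} x)"
    using integrable_mu_Icc[OF \<alpha>] by simp
  show "(\<lambda>x. norm (truncate f k x) powr q) \<in> borel_measurable (mu \<alpha>)" by measurable
  show "AE x in mu \<alpha>. norm (norm (truncate f k x) powr q) \<le> norm (real k powr q * indicator {0..real k} x)"
    using q by (intro AE_I2) (auto simp: truncate_def intro!: powr_mono2)
qed

lemma multiplier_truncate:
  assumes \<alpha>: "\<alpha> \<ge> -1/2" and f: "f \<in> Lp p (mu \<alpha>)" and p: "p > 0"
    and fp: "integrable (mu \<alpha>) (\<lambda>y. norm (f y) * profile \<alpha> y)" and M: "is_multiplier \<alpha> p M"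
  shows "AE x in mu \<alpha>. M (truncate f k) x = (\<integral>y. truncate f k y * complex_of_real (kernel \<alpha> x y) \<partial>mu \<alpha>)"
proof -
  have fm: "f \<in> borel_measurable (mu \<alpha>)" using f by (simp add: Lp_def)
  have "truncate f k \<in> Lp 2 (mu \<alpha>) \<inter> Lp p (mu \<alpha>)" "truncate f k \<in> Lp 1 (mu \<alpha>)"
    using truncate_powr_integrable[OF \<alpha> fm, of 1 k] truncate_powr_integrable[OF \<alpha> fm, of 2 k]
      truncate_powr_integrable[OF \<alpha> fm p, of k] truncate_measurable[OF fm] by (auto simp: Lp_def)
  then have i: "integrable (mu \<alpha>) (truncate f k)" and "multiplier_L2 \<alpha> (truncate f k) (M (truncate f k))"
    using M by (auto simp: Lp_1_iff is_multiplier_def)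
  from multiplier_L2_eq_hankel[OF \<alpha> this] AE_space show ?thesis
    by eventually_elim (simp add: kernel_integral_eq_hankel[OF \<alpha> i])
qed

text \<open>The operator acts on functions and is additive only up to null sets, so the difference
  of the images is replaced by the image \<open>w k\<close> of the difference. Boundedness makes the
  p-th powers of its norm tend to 0 in L^1, and L^1 convergence yields a subsequence converging
  almost everywhere.\<close>

lemma bounded_operator_AE_subseq:
  assumes T: "bounded_Lp_operator p M T" and p: "p > 0" and u: "\<And>k. u k \<in> Lp p M" and f: "f \<in> Lp p M"
    and d: "\<And>k. (\<lambda>x. u k x - f x) \<in> Lp p M"
    and lim: "(\<lambda>k. \<integral>x. norm (u k x - f x) powr p \<partial>M) \<longlonglongrightarrow> 0"
  shows "\<exists>r. strict_mono r \<and> (AE x in M. (\<lambda>k. T (u (r k)) x) \<longlonglongrightarrow> T f x)"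
proof -
  define w where "w k = T (\<lambda>x. u k x - f x)" for k
  have w: "w k \<in> Lp p M" for k using T d by (auto simp: bounded_Lp_operator_def w_def)
  have add: "AE x in M. T (u k) x = w k x + T f x" for k
  proof -
    have "AE x in M. T (\<lambda>y. g y + h y) x = T g x + T h x" if "g \<in> Lp p M" "h \<in> Lp p M" for g h
      using T that unfolding bounded_Lp_operator_def by blast
    from this[OF d f] have "AE x in M. T (\<lambda>y. (u k y - f y) + f y) x = T (\<lambda>x. u k x - f x) x + T f x" .
    then show ?thesis by (simp add: w_def)
  qed
  obtain C where C: "\<And>g. g \<in> Lp p M \<Longrightarrow> Lp_norm p M (T g) \<le> C * Lp_norm p M g"
    using T unfolding bounded_Lp_operator_def by blast
  have wi: "integrable M (\<lambda>x. norm (w k x) powr p)" for k using w by (auto simp: Lp_def)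
  have bound: "(\<integral>x. norm (w k x) powr p \<partial>M) \<le> \<bar>C\<bar> powr p * (\<integral>x. norm (u k x - f x) powr p \<partial>M)" for k
  proof -
    let ?a = "\<integral>x. norm (w k x) powr p \<partial>M" and ?b = "\<integral>x. norm (u k x - f x) powr p \<partial>M"
    have a: "?a \<ge> 0" and b: "?b \<ge> 0" by (simp_all add: integral_nonneg_AE)
    have "?a powr (1 / p) \<le> C * ?b powr (1 / p)"
      using C[OF d, of k] by (simp add: Lp_norm_def w_def)
    also have "\<dots> \<le> \<bar>C\<bar> * ?b powr (1 / p)" by (intro mult_right_mono) auto
    finally have "(?a powr (1 / p)) powr p \<le> (\<bar>C\<bar> * ?b powr (1 / p)) powr p"
      using p by (intro powr_mono2) auto
    then show ?thesis using a b p by (simp add: powr_powr powr_mult)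
  qed
  have "(\<lambda>k. \<integral>x. norm (norm (w k x) powr p) \<partial>M) \<longlonglongrightarrow> 0"
  proof (rule tendsto_sandwich[OF _ _ tendsto_const])
    show "(\<lambda>k. \<bar>C\<bar> powr p * (\<integral>x. norm (u k x - f x) powr p \<partial>M)) \<longlonglongrightarrow> 0"
      using tendsto_mult_left[OF lim, of "\<bar>C\<bar> powr p"] by simp
  qed (use bound in \<open>auto simp: integral_nonneg_AE\<close>)
  then obtain r :: "nat \<Rightarrow> nat" where r: "strict_mono r" "AE x in M. (\<lambda>k. norm (w (r k) x) powr p) \<longlonglongrightarrow> 0"
    using tendsto_L1_AE_subseq[where u = "\<lambda>k x. norm (w k x) powr p", OF wi] by blast
  have "AE x in M. \<forall>k. T (u k) x = w k x + T f x"
    using add by (simp add: AE_all_countable)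
  with r(2) have "AE x in M. (\<lambda>k. T (u (r k)) x) \<longlonglongrightarrow> T f x"
  proof eventually_elim
    case (elim x)
    have "(\<lambda>k. (norm (w (r k) x) powr p) powr (1 / p)) \<longlonglongrightarrow> 0 powr (1 / p)"
      using elim(1) p by (intro tendsto_powr') auto
    then have "(\<lambda>k. norm (w (r k) x)) \<longlonglongrightarrow> 0" using p by (simp add: powr_powr)
    then have "(\<lambda>k. w (r k) x + T f x) \<longlonglongrightarrow> 0 + T f x"
      by (intro tendsto_add tendsto_const) (simp add: tendsto_norm_zero_iff)
    then show ?case using elim(2) by simp
  qed
  with r(1) show ?thesis by blast
qed

text \<open>Both sides agree on truncations. The left one converges almost everywhere along a
  subsequence by boundedness of the operator, the right one at every point by dominated
  convergence.\<close>

lemma multiplier_eq_kernel_integral: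
  assumes \<alpha>: "\<alpha> \<ge> -1/2" and f: "f \<in> Lp p (mu \<alpha>)" and p: "p > 0"
    and fp: "integrable (mu \<alpha>) (\<lambda>y. norm (f y) * profile \<alpha> y)" and M: "is_multiplier \<alpha> p M"
  shows "AE x in mu \<alpha>. M f x = (\<integral>y. f y * complex_of_real (kernel \<alpha> x y) \<partial>mu \<alpha>)"
proof -
  have fm[measurable]: "f \<in> borel_measurable (mu \<alpha>)" and fi: "integrable (mu \<alpha>) (\<lambda>x. norm (f x) powr p)"
    using f by (auto simp: Lp_def)
  note [measurable] = truncate_measurable[OF fm]
  have tL: "truncate f k \<in> Lp p (mu \<alpha>)" for k
    using p by (intro Lp_mono[OF f] truncate_norm_le) auto
  have dL: "(\<lambda>x. truncate f k x - f x) \<in> Lp p (mu \<alpha>)" for k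
    using p by (intro Lp_mono[OF f] truncate_norm_le) auto
  have "(\<lambda>k. \<integral>x. norm (truncate f k x - f x) powr p \<partial>mu \<alpha>) \<longlonglongrightarrow> (\<integral>x. 0 \<partial>mu \<alpha>)"
  proof (rule integral_dominated_convergence[OF _ _ fi])
    show "AE x in mu \<alpha>. (\<lambda>k. norm (truncate f k x - f x) powr p) \<longlonglongrightarrow> 0"
    proof (rule AE_I2)
      fix x
      have "(\<lambda>k. norm (truncate f k x - f x)) \<longlonglongrightarrow> 0"
        using truncate_tendsto[of f x] by (simp add: LIM_zero tendsto_norm_zero)
      then have "(\<lambda>k. norm (truncate f k x - f x) powr p) \<longlonglongrightarrow> 0 powr p"
        using p by (intro tendsto_powr') auto
      then show "(\<lambda>k. norm (truncate f k x - f x) powr p) \<longlonglongrightarrow> 0" by simp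
    qed
    show "AE x in mu \<alpha>. norm (norm (truncate f k x - f x) powr p) \<le> norm (f x) powr p" for k
      using p by (auto intro!: powr_mono2 truncate_norm_le)
  qed measurable
  then obtain r where r: "strict_mono r" "AE x in mu \<alpha>. (\<lambda>k. M (truncate f (r k)) x) \<longlonglongrightarrow> M f x"
    using bounded_operator_AE_subseq[of p "mu \<alpha>" M "truncate f" f] M p tL f dL by (auto simp: is_multiplier_def)
  have tr: "AE x in mu \<alpha>. \<forall>k. M (truncate f k) x = (\<integral>y. truncate f k y * complex_of_real (kernel \<alpha> x y) \<partial>mu \<alpha>)"
    unfolding AE_all_countable using multiplier_truncate[OF \<alpha> f p fp M] by blast
  \<comment> \<open>The point \<open>x\<close> is fixed, so the sum in \<open>kernel_bound\<close>
    is a constant and \<open>profile\<close> times the norm of \<open>f\<close> is the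
    majorant.\<close>
  have K: "(\<lambda>k. \<integral>y. truncate f k y * complex_of_real (kernel \<alpha> x y) \<partial>mu \<alpha>) \<longlonglongrightarrow> (\<integral>y. f y * complex_of_real (kernel \<alpha> x y) \<partial>mu \<alpha>)"
    if x: "x > 0" for x
  proof (rule integral_dominated_convergence)
    define S where "S = (\<Sum>n. jbd \<alpha> n * \<bar>j \<alpha> n x\<bar>)"
    show "integrable (mu \<alpha>) (\<lambda>y. S * (norm (f y) * profile \<alpha> y))" using fp by simp
    have "(\<lambda>z. ker \<alpha> (fst z) (snd z)) \<in> borel_measurable (mu \<alpha> \<Otimes>\<^sub>M mu \<alpha>)"
      by (rule measurable_ker[OF \<alpha>]; rule measurable_compose[OF _ measurable_id_mu]; rule measurable_fst measurable_snd)
    moreover have "(\<lambda>t. indicator {0..1} t * ker \<alpha> x t) \<in> borel_measurable (mu \<alpha>)"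
      using measurable_ker[OF \<alpha> _ measurable_id_mu] by (intro borel_measurable_times measurable_muI[of "indicator {0..1}"]) auto
    ultimately have [measurable]: "kernel \<alpha> x \<in> borel_measurable (mu \<alpha>)"
      unfolding kernel_def[abs_def] by (intro mu.borel_measurable_lebesgue_integral) (simp add: split_beta', measurable)
    show "(\<lambda>y. f y * complex_of_real (kernel \<alpha> x y)) \<in> borel_measurable (mu \<alpha>)" by measurable
    show "(\<lambda>y. truncate f k y * complex_of_real (kernel \<alpha> x y)) \<in> borel_measurable (mu \<alpha>)" for k by measurable
    show "AE y in mu \<alpha>. (\<lambda>k. truncate f k y * complex_of_real (kernel \<alpha> x y)) \<longlonglongrightarrow> f y * complex_of_real (kernel \<alpha> x y)"
      by (intro AE_I2 tendsto_mult_right truncate_tendsto)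
    show "AE y in mu \<alpha>. norm (truncate f k y * complex_of_real (kernel \<alpha> x y)) \<le> S * (norm (f y) * profile \<alpha> y)" for k
    proof (rule AE_I2)
      fix y assume "y \<in> space (mu \<alpha>)"
      then have y: "y > 0" by simp
      have "norm (truncate f k y) * \<bar>kernel \<alpha> x y\<bar> \<le> norm (f y) * (S * profile \<alpha> y)"
        unfolding S_def by (intro mult_mono truncate_norm_le kernel_bound \<alpha> x y) auto
      then show "norm (truncate f k y * complex_of_real (kernel \<alpha> x y)) \<le> S * (norm (f y) * profile \<alpha> y)"
        by (simp add: norm_mult mult_ac)
    qed
  qed
  from r(2) tr AE_space show ?thesis
  proof eventually_elim
    case (elim x)
    have "(\<lambda>k. \<integral>y. truncate f (r k) y * complex_of_real (kernel \<alpha> x y) \<partial>mu \<alpha>) \<longlonglongrightarrow> (\<integral>y. f y * complex_of_real (kernel \<alpha> x y) \<partial>mu \<alpha>)"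
      using LIMSEQ_subseq_LIMSEQ[OF K r(1)] elim(3) by (simp add: o_def)
    then show ?case using elim(1,2) LIMSEQ_unique by auto
  qed
qed

text \<open>Dominated convergence for series, with the terms at r = 1 as majorant. Leaving the
  exponents arbitrary covers both the linear ones of \<open>P\<close> and the quadratic ones of
  \<open>W\<close>.\<close>

lemma abel_type_limit:
  fixes c :: "nat \<Rightarrow> complex" and e :: "nat \<Rightarrow> real"
  assumes c: "summable (\<lambda>n. norm (c n))" and e: "\<And>n. e n \<ge> 0"
  shows "((\<lambda>r. \<Sum>n. complex_of_real (r powr e n) * c n) \<longlongrightarrow> (\<Sum>n. c n)) (at_left 1)"
proof -
  have ev: "eventually (\<lambda>r::real. 0 < r \<and> r < 1) (at_left 1)"
    using eventually_at_left_real[of 0 "1::real"] by simp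
  have "((\<lambda>r. \<Sum>n. complex_of_real (r powr e n) * c n) \<longlongrightarrow> (\<Sum>n. complex_of_real (1 powr e n) * c n)) (at_left 1)"
  proof (rule tannerys_theorem[THEN conjunct2, THEN conjunct2, OF _ _ c])
    show "((\<lambda>r. complex_of_real (r powr e n) * c n) \<longlongrightarrow> complex_of_real (1 powr e n) * c n) (at_left 1)" for n
      by (intro tendsto_intros) auto
    have "eventually (\<lambda>(n::nat, r::real). 0 < r \<and> r < 1) (at_top \<times>\<^sub>F at_left 1)"
      using eventually_prod2[OF trivial_limit_sequentially, of "\<lambda>r::real. 0 < r \<and> r < 1" "at_left 1"] ev by simp
    then show "eventually (\<lambda>(n, r). norm (complex_of_real (r powr e n) * c n) \<le> norm (c n)) (at_top \<times>\<^sub>F at_left 1)"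
    proof (rule eventually_mono, safe)
      fix n and r :: real assume "0 < r" "r < 1"
      then have "r powr e n \<le> 1" using e by (intro powr_le1) auto
      then show "norm (complex_of_real (r powr e n) * c n) \<le> norm (c n)"
        by (simp add: norm_mult mult_left_le_one_le)
    qed
  qed simp
  then show ?thesis by simp
qed

theorem theorem7:
  fixes \<alpha> p :: real
    and M :: "(real \<Rightarrow> complex) \<Rightarrow> real \<Rightarrow> complex"
    and f :: "real \<Rightarrow> complex"
  assumes "\<alpha> \<ge> -1/2"
    and "p0 \<alpha> < p" and "ereal p < p1 \<alpha>"
    and "is_multiplier \<alpha> p M"
    and "f \<in> Lp p (mu \<alpha>)"
  shows "(AE x in lborel. 0 < x \<longrightarrow> ((\<lambda>r. P \<alpha> r f x) \<longlongrightarrow> M f x) (at_left 1)) \<and>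
         (AE x in lborel. 0 < x \<longrightarrow> ((\<lambda>r. W \<alpha> r f x) \<longlongrightarrow> M f x) (at_left 1))"
proof -
  have p: "p > 0" using p0_ge_1[OF assms(1)] assms(2) by linarith
  have fm: "f \<in> borel_measurable (mu \<alpha>)" using assms(5) by (simp add: Lp_def)
  note fp = Lp_profile_integrable[OF assms(1-3,5)]
  have lim: "((\<lambda>r. \<Sum>n. complex_of_real (r powr e n) * coef \<alpha> f n * complex_of_real (j \<alpha> n x)) \<longlongrightarrow> M f x) (at_left 1)"
    if x: "x > 0" and e: "\<And>n. e n \<ge> 0" and Mf: "M f x = (\<integral>y. f y * complex_of_real (kernel \<alpha> x y) \<partial>mu \<alpha>)" for x e
    using abel_type_limit[OF summable_coef[OF assms(1) fm fp x] e] coef_series_sums[OF assms(1) fm fp x] Mf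
    by (simp add: sums_iff mult.assoc)
  have e: "\<alpha> + 2 * real n + 1 \<ge> 0" for n using assms(1) by simp
  \<comment> \<open>The only exceptional null set is the one of this identity; at every other point
    both means converge.\<close>
  have AE: "AE x in lborel. 0 < x \<longrightarrow> M f x = (\<integral>y. f y * complex_of_real (kernel \<alpha> x y) \<partial>mu \<alpha>)"
    using multiplier_eq_kernel_integral[OF assms(1,5) p fp assms(4)] by (simp add: AE_mu)
  have "AE x in lborel. 0 < x \<longrightarrow> ((\<lambda>r. P \<alpha> r f x) \<longlongrightarrow> M f x) (at_left 1)"
    using AE
  proof eventually_elim
    case (elim x)
    then show ?case unfolding P_def using lim[of x "\<lambda>n. \<alpha> + 2 * real n + 1"] e by blast
  qed
  moreover have "AE x in lborel. 0 < x \<longrightarrow> ((\<lambda>r. W \<alpha> r f x) \<longlongrightarrow> M f x) (at_left 1)"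
    using AE
  proof eventually_elim
    case (elim x)
    then show ?case unfolding W_def using lim[of x "\<lambda>n. (\<alpha> + 2 * real n + 1)\<^sup>2"] by simp
  qed
  ultimately show ?thesis by blast
qed

end
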